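(* Let $M$ be a positive definite symmetric $d\times d$ matrix and let $f(x)=[1-\langle x,Mx\rangle]^+$ for $x\in\mathbb R^d$. (a) If $\{U_i\}_{i\ge1}$ is a sequence of i.i.d. uniform random variables on $\mathbb S^{d-1}$ and the extremal eigenvalues of $M$ satisfy $\lambda_{\max}\le2\lambda_{\min}$, then for every $n\ge1$ $$E\bigl(\|S_{U_1\dots U_n}f-f^*\|_\infty\bigr)\ge\frac14\,\|f-f^*\|_\infty\,3^{-n}.$$ (b) If $M$ is not a multiple of the identity, then there exists a dense sequence $\{u_i\}_{i\ge1}$ in $\mathbb S^{d-1}$ such that $S_{u_1\dots u_n}f$ has no limit in $\mathcal C_c^+(\mathbb R^d)$ (in the topology of uniform convergence) as $n\to\infty$.
   Context: $[t]^+=\max\{t,0\}$; $\langle\cdot,\cdot\rangle$ is the Euclidean inner product; $\lambda_{\max},\lambda_{\min}$ are the largest and smallest eigenvalues of $M$. $\mathcal C_c^+(\mathbb R^d)$ is the space of nonnegative continuous compactly supported functions. For $A\subset\mathbb R^d$ of finite volume, $A^*$ is the open ball centered at the origin of the same volume; $f^*$ is the lower semicontinuous radially decreasing function with $\{f^*>t\}=\{f>t\}^*$ for all $t>0$ (symmetric decreasing rearrangement). For $u\in\mathbb S^{d-1}$, the Steiner symmetrization $S_uf$ replaces the restriction of $f$ to each line $\{\xi+tu:t\in\mathbb R\}$, $\xi\perp u$, by its one-dimensional symmetric decreasing rearrangement in $t$. Set $S_{u_1\dots u_n}=S_{u_n}\circ\dots\circ S_{u_1}$. *)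

theory Defs
  imports "HOL-Analysis.Analysis" "HOL-Probability.Probability"
begin

definition symmetric_posdef :: "real ^ 'n ^ 'n \<Rightarrow> bool" where
  "symmetric_posdef M \<longleftrightarrow> transpose M = M \<and> (\<forall>x. x \<noteq> 0 \<longrightarrow> x \<bullet> (M *v x) > 0)"

definition eigenvalues :: "real ^ 'n ^ 'n \<Rightarrow> real set" where
  "eigenvalues M = {l. \<exists>v. v \<noteq> 0 \<and> M *v v = l *\<^sub>R v}"

text \<open>For symmetric \<open>M\<close> the set of eigenvalues is finite and nonempty, so these are the
  extremal eigenvalues.\<close>

definition lambda_max :: "real ^ 'n ^ 'n \<Rightarrow> real" where
  "lambda_max M = Max (eigenvalues M)"

definition lambda_min :: "real ^ 'n ^ 'n \<Rightarrow> real" where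
  "lambda_min M = Min (eigenvalues M)"

definition Cc_plus :: "('a::euclidean_space \<Rightarrow> real) set" where
  "Cc_plus = {f. continuous_on UNIV f \<and> (\<forall>x. 0 \<le> f x) \<and> compact (closure {x. f x \<noteq> 0})}"

text \<open>The supremum norm; meaningful for bounded \<open>g\<close> only.\<close>

definition sup_norm :: "('a \<Rightarrow> real) \<Rightarrow> real" where
  "sup_norm g = (SUP x. \<bar>g x\<bar>)"


section \<open>Symmetric decreasing rearrangement\<close>

text \<open>\<open>A\<^sup>*\<close>; it is well defined for every \<open>A\<close> of finite volume (\<open>sym_ball_unique\<close>), and empty
  for null sets.\<close>

definition sym_ball :: "'a::euclidean_space set \<Rightarrow> 'a set" where
  "sym_ball A = (THE B. \<exists>r. B = ball 0 r \<and> emeasure lebesgue B = emeasure lebesgue A)"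

definition lower_semicont :: "('a::topological_space \<Rightarrow> real) \<Rightarrow> bool" where
  "lower_semicont g \<longleftrightarrow> (\<forall>t. open {x. g x > t})"

definition radially_decreasing :: "('a::real_normed_vector \<Rightarrow> real) \<Rightarrow> bool" where
  "radially_decreasing g \<longleftrightarrow> (\<forall>x y. norm x \<le> norm y \<longrightarrow> g y \<le> g x)"

text \<open>Nonnegativity has to be required explicitly: the level sets for \<open>t > 0\<close> do not see the
  values where \<open>g\<close> is not positive.\<close>

definition is_rearrangement ::
    "('a::euclidean_space \<Rightarrow> real) \<Rightarrow> ('a \<Rightarrow> real) \<Rightarrow> bool" where
  "is_rearrangement f g \<longleftrightarrow>
     (\<forall>x. 0 \<le> g x) \<and> lower_semicont g \<and> radially_decreasing g \<and>
     (\<forall>t>0. {x. g x > t} = sym_ball {x. f x > t})"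

text \<open>\<open>f\<^sup>*\<close>; see \<open>rearrangement_ex1\<close> for existence and uniqueness. The domain is an arbitrary
  Euclidean space because the Steiner symmetrization uses the case of \<open>real\<close>.\<close>

definition rearrangement :: "('a::euclidean_space \<Rightarrow> real) \<Rightarrow> 'a \<Rightarrow> real" where
  "rearrangement f = (THE g. is_rearrangement f g)"


section \<open>Steiner symmetrization\<close>

text \<open>Every \<open>x\<close> is \<open>\<xi> + t u\<close> with \<open>t = \<langle>x, u\<rangle>\<close> and \<open>\<xi> = x - t u\<close> orthogonal to the unit
  vector \<open>u\<close>.\<close>

definition steiner :: "'a::euclidean_space \<Rightarrow> ('a \<Rightarrow> real) \<Rightarrow> 'a \<Rightarrow> real" where
  "steiner u f x = rearrangement (\<lambda>t::real. f ((x - (x \<bullet> u) *\<^sub>R u) + t *\<^sub>R u)) (x \<bullet> u)"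

text \<open>\<open>steiner_seq u n\<close> is the composition with \<open>steiner (u 1)\<close> applied first and
  \<open>steiner (u n)\<close> applied last; the value \<open>u 0\<close> is not used.\<close>

primrec steiner_seq ::
    "(nat \<Rightarrow> 'a::euclidean_space) \<Rightarrow> nat \<Rightarrow> ('a \<Rightarrow> real) \<Rightarrow> 'a \<Rightarrow> real" where
  "steiner_seq u 0 f = f"
| "steiner_seq u (Suc n) f = steiner (u (Suc n)) (steiner_seq u n f)"


section \<open>Independent uniform directions\<close>

text \<open>The uniform distribution (normalized surface measure) on the unit sphere, realized as the
  radial projection of the uniform distribution on the unit ball. It is regarded as a Borel
  measure on the ambient space.\<close>

definition uniform_sphere :: "'a::euclidean_space measure" where
  "uniform_sphere = distr (uniform_measure lborel (ball 0 1)) borel (\<lambda>x. x /\<^sub>R norm x)"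

definition iid_uniform_sphere ::
    "'w measure \<Rightarrow> (nat \<Rightarrow> 'w \<Rightarrow> 'a::euclidean_space) \<Rightarrow> bool" where
  "iid_uniform_sphere P U \<longleftrightarrow>
     prob_space.indep_vars P (\<lambda>_. borel) U {1..} \<and>
     (\<forall>i\<ge>1. (\<forall>\<omega>\<in>space P. U i \<omega> \<in> sphere 0 1) \<and> distr P borel (U i) = uniform_sphere)"


section \<open>Well-definedness\<close>

lemma emeasure_ball_less_iff:
  fixes r s :: real
  assumes "0 \<le> r" "0 \<le> s"
  shows "emeasure lebesgue (ball (0::'a::euclidean_space) r) < emeasure lebesgue (ball (0::'a) s)
           \<longleftrightarrow> r < s"
proof -
  have "unit_ball_vol (real DIM('a)) > 0" by simp
  moreover have "r ^ DIM('a) < s ^ DIM('a) \<longleftrightarrow> r < s"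
    using assms using power_mono_iff[of s r "DIM('a)"] by (simp add: not_le[symmetric])
  ultimately show ?thesis
    using assms by (simp add: emeasure_ball ennreal_less_iff)
qed

lemma sym_ball_unique:
  fixes A :: "'a::euclidean_space set"
  assumes "emeasure lebesgue A < \<infinity>"
  shows "\<exists>!B::'a set. \<exists>r. B = ball 0 r \<and> emeasure lebesgue B = emeasure lebesgue A"
proof -
  let ?v = "measure lebesgue A / unit_ball_vol (real DIM('a))"
  define \<rho> where "\<rho> = root DIM('a) ?v"
  have r0: "0 \<le> \<rho>" by (simp add: \<rho>_def)
  have "\<rho> ^ DIM('a) = ?v" by (simp add: \<rho>_def real_root_pow_pos2)
  then have "emeasure lebesgue (ball (0::'a) \<rho>) = ennreal (measure lebesgue A)"
    using r0 by (simp add: emeasure_ball)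
      (metis less_irrefl nonzero_mult_div_cancel_left of_nat_0_le_iff times_divide_eq_right unit_ball_vol_pos)
  also have "\<dots> = emeasure lebesgue A"
    using assms by (simp add: emeasure_eq_ennreal_measure)
  finally have ex: "emeasure lebesgue (ball (0::'a) \<rho>) = emeasure lebesgue A" .
  have "ball (0::'a) r = ball 0 s"
    if "emeasure lebesgue (ball (0::'a) r) = emeasure lebesgue (ball (0::'a) s)" for r s
  proof -
    have *: "ball (0::'a) t = ball 0 (max 0 t)" for t by (auto simp: max_def)
    from that have "max 0 r = max 0 s"
      using emeasure_ball_less_iff[of "max 0 r" "max 0 s", where 'a='a]
        emeasure_ball_less_iff[of "max 0 s" "max 0 r", where 'a='a]
      by (metis * max.cobounded1 less_irrefl linorder_less_linear)
    then show ?thesis by (metis *)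
  qed
  with ex show ?thesis
    by (metis (no_types, lifting))
qed

lemma sym_ballE:
  fixes A :: "'a::euclidean_space set"
  assumes "emeasure lebesgue A < \<infinity>"
  obtains r where "r \<ge> 0" "sym_ball A = ball 0 r"
    "emeasure lebesgue (ball (0::'a) r) = emeasure lebesgue A"
proof -
  from theI'[OF sym_ball_unique[OF assms]] obtain r where
    r: "sym_ball A = ball 0 r" "emeasure lebesgue (sym_ball A) = emeasure lebesgue A"
    unfolding sym_ball_def by blast
  moreover have "ball (0::'a) r = ball 0 (max 0 r)" by (auto simp: max_def)
  ultimately show ?thesis using that[of "max 0 r"] by simp
qed

lemma mem_sym_ball_iff:
  fixes A :: "'a::euclidean_space set"
  assumes "emeasure lebesgue A < \<infinity>"
  shows "x \<in> sym_ball A \<longleftrightarrow> emeasure lebesgue (ball (0::'a) (norm x)) < emeasure lebesgue A"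
  using assms
  by (rule sym_ballE)
    (metis emeasure_ball_less_iff norm_ge_zero mem_ball_0)

lemma rearrangement_ex1:
  fixes f :: "'a::euclidean_space \<Rightarrow> real"
  assumes meas: "\<And>t. t > 0 \<Longrightarrow> {x. f x > t} \<in> sets lebesgue"
    and fin: "\<And>t. t > 0 \<Longrightarrow> emeasure lebesgue {x. f x > t} < \<infinity>"
    and bdd: "\<And>x. f x \<le> B"
  shows "\<exists>!g. is_rearrangement f g"
proof -
  let ?S = "\<lambda>t. sym_ball {x. f x > t}"
  let ?T = "\<lambda>x. insert 0 {t. t > 0 \<and> x \<in> ?S t}"
  define g where "g x = Sup (?T x)" for x
  have mem: "x \<in> ?S t \<longleftrightarrow> emeasure lebesgue (ball (0::'a) (norm x)) < emeasure lebesgue {x. f x > t}"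
    if "t > 0" for x t
    using mem_sym_ball_iff[OF fin[OF that]] .
  have empty: "?S t = {}" if "t > 0" "t \<ge> B" for t
  proof -
    have "{x. f x > t} = {}" using order_trans[OF bdd that(2)] by (auto simp: not_less)
    then show ?thesis using mem[OF that(1)] by auto
  qed
  have bT: "bdd_above (?T x)" for x
  proof (rule bdd_aboveI)
    fix t assume "t \<in> ?T x"
    then show "t \<le> max 0 B" using empty[of t] by fastforce
  qed
  have g0: "0 \<le> g x" for x
    unfolding g_def using bT by (intro cSup_upper) auto
  have level: "{x. g x > t} = ?S t" if t: "t > 0" for t
  proof (intro equalityI subsetI)
    fix x assume "x \<in> {x. g x > t}"
    then obtain s where s: "s \<in> ?T x" "t < s"
      unfolding g_def using less_cSup_iff[OF _ bT] by blast
    then have "s > 0" "x \<in> ?S s" using t by auto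
    moreover have "emeasure lebesgue {x. f x > s} \<le> emeasure lebesgue {x. f x > t}"
      using s t meas by (intro emeasure_mono) auto
    ultimately show "x \<in> ?S t" using mem t by (meson less_le_trans)
  next
    fix x assume x: "x \<in> ?S t"
    define A where "A n = {x. f x > t + 1 / real (Suc n)}" for n
    have pos: "t + 1 / real (Suc n) > 0" for n using t by (simp add: add_pos_pos)
    have "incseq A"
    proof (rule incseq_SucI)
      fix n
      have "1 / real (Suc (Suc n)) \<le> 1 / real (Suc n)" by (simp add: frac_le)
      then show "A n \<subseteq> A (Suc n)" unfolding A_def by fastforce
    qed
    moreover have "range A \<subseteq> sets lebesgue" using meas pos by (auto simp: A_def)
    moreover have "(\<Union>n. A n) = {x. f x > t}"
    proof (intro equalityI subsetI)
      fix y assume "y \<in> {x. f x > t}"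
      then have "0 < f y - t" by simp
      then obtain n where "1 / real (Suc n) < f y - t"
        using reals_Archimedean unfolding inverse_eq_divide by blast
      then have "y \<in> A n" by (simp add: A_def)
      then show "y \<in> (\<Union>n. A n)" by blast
    next
      fix y assume "y \<in> (\<Union>n. A n)"
      then obtain n where "f y > t + 1 / real (Suc n)" by (auto simp: A_def)
      moreover have "1 / real (Suc n) > 0" by simp
      ultimately show "y \<in> {x. f x > t}" unfolding mem_Collect_eq by linarith
    qed
    ultimately have "(SUP n. emeasure lebesgue (A n)) = emeasure lebesgue {x. f x > t}"
      using SUP_emeasure_incseq[of A lebesgue] by simp
    then obtain n where "emeasure lebesgue (ball (0::'a) (norm x)) < emeasure lebesgue (A n)"
      using x mem[OF t] by (metis (no_types, lifting) less_SUP_iff)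
    then have "x \<in> ?S (t + 1 / real (Suc n))"
      using mem[OF pos] by (simp add: A_def)
    then have "t + 1 / real (Suc n) \<le> g x"
      unfolding g_def using bT pos by (intro cSup_upper) auto
    moreover have "1 / real (Suc n) > 0" by simp
    ultimately show "x \<in> {x. g x > t}" unfolding mem_Collect_eq by linarith
  qed
  have openS: "open (?S t)" if "t > 0" for t
    using sym_ballE[OF fin[OF that]] by (metis open_ball)
  have "open {x. g x > t}" for t
  proof -
    have "{x. g x > t} = (if t < 0 then UNIV else (\<Union>s\<in>{s. s > t}. {x. g x > s}))"
      using g0 dense by (auto intro: less_le_trans dest: less_trans)
    moreover have "open {x. g x > s}" if "s > 0" for s using openS level that by simp
    ultimately show ?thesis by (auto intro!: open_UN)
  qed
  moreover have "g y \<le> g x" if "norm x \<le> norm y" for x y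
  proof -
    have "emeasure lebesgue (ball (0::'a) (norm x)) \<le> emeasure lebesgue (ball (0::'a) (norm y))"
      using that by (intro emeasure_mono) auto
    then have "?T y \<subseteq> ?T x" using mem by (auto intro: le_less_trans)
    then show ?thesis unfolding g_def using bT by (intro cSup_subset_mono) auto
  qed
  ultimately have "is_rearrangement f g"
    unfolding is_rearrangement_def lower_semicont_def radially_decreasing_def
    using g0 level by blast
  moreover have "h = g" if h: "is_rearrangement f h" for h
  proof
    fix x
    have *: "h x > t \<longleftrightarrow> g x > t" if "t > 0" for t
      using h level[OF that] that unfolding is_rearrangement_def by blast
    have "0 \<le> h x" using h unfolding is_rearrangement_def by blast
    show "h x = g x"
    proof (rule linorder_cases[of "h x" "g x"])
      assume "h x < g x"
      then obtain t where "h x < t" "t < g x" using dense by blast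
      then show ?thesis using *[of t] \<open>0 \<le> h x\<close> by simp
    next
      assume "g x < h x"
      then obtain t where "g x < t" "t < h x" using dense by blast
      then show ?thesis using *[of t] g0[of x] by simp
    qed
  qed
  ultimately show ?thesis by blast
qed

lemma uniform_sphere_measurable [measurable]:
  "(\<lambda>x::'a::euclidean_space. x /\<^sub>R norm x) \<in> borel_measurable borel"
  by measurable

lemma unit_ball_emeasure:
  "emeasure lborel (ball (0::'a::euclidean_space) 1) \<noteq> 0"
  "emeasure lborel (ball (0::'a::euclidean_space) 1) \<noteq> \<infinity>"
proof -
  have "unit_ball_vol (real DIM('a)) > 0" by simp
  then show "emeasure lborel (ball (0::'a) 1) \<noteq> 0" "emeasure lborel (ball (0::'a) 1) \<noteq> \<infinity>"
    by (simp_all add: emeasure_ball less_imp_neq[symmetric])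
qed

lemma prob_space_uniform_sphere: "prob_space (uniform_sphere :: 'a::euclidean_space measure)"
proof -
  interpret prob_space "uniform_measure lborel (ball (0::'a) 1)"
    using unit_ball_emeasure by (rule prob_space_uniform_measure)
  show ?thesis unfolding uniform_sphere_def
    by (rule prob_space_distr) simp
qed

lemma AE_uniform_sphere: "AE x in uniform_sphere. x \<in> sphere (0::'a::euclidean_space) 1"
proof -
  have "AE x in lborel. (x::'a) \<noteq> 0"
    by (rule AE_I[of _ _ "{0}"]) auto
  then have "AE x in uniform_measure lborel (ball (0::'a) 1). x /\<^sub>R norm x \<in> sphere 0 1"
    by (intro AE_uniform_measureI) auto
  then show ?thesis unfolding uniform_sphere_def
    by (subst AE_distr_iff) (auto simp: uniform_measure_def)
qed

lemma lborel_distr_orthogonal: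
  fixes T :: "real ^ 'n :: {finite,wellorder} \<Rightarrow> real ^ 'n :: _"
  assumes "orthogonal_transformation T"
  shows "distr lborel borel T = lborel"
proof (rule lborel_eqI[symmetric])
  fix l u :: "real ^ 'n :: _"
  assume "\<And>b. b \<in> Basis \<Longrightarrow> l \<bullet> b \<le> u \<bullet> b"
  then have box: "emeasure lborel (box l u) = (\<Prod>b\<in>Basis. (u - l) \<bullet> b)" by simp
  have lin: "linear T" using assms by (rule orthogonal_transformation_linear)
  have m: "T \<in> borel_measurable borel"
    using lin by (simp add: borel_measurable_continuous_onI linear_continuous_on linear_linear)
  have inv: "orthogonal_transformation (inv T)"
    using assms by (rule orthogonal_transformation_inv)
  have eq: "T -` box l u = inv T ` box l u"
    using assms by (simp add: bij_vimage_eq_inv_image orthogonal_transformation_bij)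
  have "inv T ` box l u \<in> lmeasurable"
    "measure lebesgue (inv T ` box l u) = measure lebesgue (box l u)"
    using measurable_orthogonal_image[OF inv lmeasurable_box] measure_orthogonal_image[OF inv lmeasurable_box]
    by blast+
  then have "emeasure lebesgue (T -` box l u) = emeasure lebesgue (box l u)"
    unfolding eq
    by (metis emeasure_eq_measure2 lmeasurable_box)
  moreover have "T -` box l u \<in> sets borel"
    using measurable_sets[OF m, of "box l u"] by simp
  ultimately have "emeasure lborel (T -` box l u) = emeasure lborel (box l u)" by simp
  then show "emeasure (distr lborel borel T) (box l u) = (\<Prod>b\<in>Basis. (u - l) \<bullet> b)"
    using m box by (simp add: emeasure_distr)
qed simp

lemma uniform_sphere_orthogonal:
  fixes T :: "real ^ 'n :: {finite,wellorder} \<Rightarrow> real ^ 'n :: _"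
  assumes T: "orthogonal_transformation T"
  shows "distr uniform_sphere borel T = uniform_sphere"
proof -
  let ?N = "\<lambda>x::real ^ 'n :: _. x /\<^sub>R norm x"
  let ?B = "ball (0::real ^ 'n :: _) 1"
  let ?U = "uniform_measure lborel ?B"
  have lin: "linear T" using T by (rule orthogonal_transformation_linear)
  have m [measurable]: "T \<in> borel_measurable borel"
    using lin by (simp add: borel_measurable_continuous_onI linear_continuous_on linear_linear)
  have comm: "T \<circ> ?N = ?N \<circ> T"
    using T by (auto simp: orthogonal_transformation_norm linear_scale[OF lin])
  have "distr ?U borel T = ?U"
  proof (rule measure_eqI)
    fix A assume "A \<in> sets (distr ?U borel T)"
    then have A [measurable]: "A \<in> sets borel" by simp
    have [measurable]: "T -` A \<in> sets borel"
      using measurable_sets[OF m A] by simp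
    have "?B \<inter> T -` A = T -` (?B \<inter> A)"
      using T by (auto simp: orthogonal_transformation_norm)
    moreover have "emeasure lborel (T -` (?B \<inter> A)) = emeasure (distr lborel borel T) (?B \<inter> A)"
      by (simp add: emeasure_distr)
    ultimately have "emeasure lborel (?B \<inter> T -` A) = emeasure lborel (?B \<inter> A)"
      by (simp add: lborel_distr_orthogonal[OF T])
    then show "emeasure (distr ?U borel T) A = emeasure ?U A"
      by (simp add: emeasure_distr)
  qed simp
  then have "distr ?U borel (?N \<circ> T) = distr ?U borel ?N"
    by (subst distr_distr[symmetric, where N=borel]) auto
  then show ?thesis
    unfolding uniform_sphere_def by (subst distr_distr) (auto simp: comm)
qed

end

theory Submission
  imports Defs
begin

text \<open>
  Completing the square on each line shows that the Steiner symmetrization in direction \<open>u\<close> maps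
  \<open>[1 - \<langle>x, Mx\<rangle>]\<^sup>+\<close> to \<open>[1 - \<langle>x, M'x\<rangle>]\<^sup>+\<close> with \<open>M' = M + a u u\<^sup>T - (Mu)(Mu)\<^sup>T / a\<close>,
  \<open>a = \<langle>u, Mu\<rangle>\<close>, so that everything happens on matrices.

  For (a), let \<open>v\<close>, \<open>w\<close> be eigenvectors of \<open>M\<close> for its largest and smallest eigenvalue
  \<open>\<Lambda>\<close>, \<open>\<lambda>\<close>, and \<open>s = \<langle>v, u\<rangle>\<close>,
  \<open>r = \<langle>w, u\<rangle>\<close>. If \<open>\<Lambda> \<le> 2 \<lambda>\<close>, testing \<open>M'\<close> against \<open>v\<close> and \<open>w\<close> shows that the spread
  \<open>\<Lambda> - \<lambda>\<close> shrinks at most by the factor \<open>1 - 3(s\<^sup>2 - s\<^sup>4) - 2(r\<^sup>2 - r\<^sup>4)\<close>, whose mean is at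
  least \<open>1/3\<close> because \<open>E(s\<^sup>2 - s\<^sup>4) = (d-1)/(d(d+2)) \<le> 2/15\<close>. The spread is comparable to the
  distance to \<open>f\<^sup>*\<close>, since \<open>f\<^sup>*\<close> is radial and lies between the caps
  \<open>[1 - \<Lambda>|x|\<^sup>2]\<^sup>+\<close> and \<open>[1 - \<lambda>|x|\<^sup>2]\<^sup>+\<close>.

  For (b), \<open>u\<close> is an eigenvector of \<open>M'\<close> with eigenvalue \<open>a\<close>, and turning the direction from \<open>u\<^sub>n\<close>
  to \<open>u\<^sub>n\<^sub>+\<^sub>1\<close> multiplies this eigenvalue at least by \<open>\<langle>u\<^sub>n, u\<^sub>n\<^sub>+\<^sub>1\<rangle>\<^sup>2\<close>. Start at a top eigenvector and
  follow a dense walk whose squared steps have a small sum: the eigenvalue stays above some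
  \<open>A > tr M / d\<close>. In a limit every direction would have Rayleigh quotient at least \<open>A\<close>, so the
  trace would be at least \<open>dA > tr M\<close>, although symmetrization never increases the trace.
\<close>

section \<open>Quadratic forms under one symmetrization step\<close>

definition qform :: "real ^ 'n ^ 'n \<Rightarrow> real ^ 'n \<Rightarrow> real" where
  "qform M x = x \<bullet> (M *v x)"

definition outer :: "real ^ 'n \<Rightarrow> real ^ 'n \<Rightarrow> real ^ 'n ^ 'n" where
  "outer u w = (\<chi> i j. u $ i * w $ j)"

text \<open>For a = <u, Mu> nonzero, subtracting (Mu)(Mu)^T / a leaves the Schur complement, a form
  that vanishes on u. Adding a u u^T restores the value a at u without coupling u to its orthogonal
  complement.\<close>

definition sstep :: "real ^ 'n ^ 'n \<Rightarrow> real ^ 'n \<Rightarrow> real ^ 'n ^ 'n" where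
  "sstep M u = M + qform M u *\<^sub>R outer u u - (1 / qform M u) *\<^sub>R outer (M *v u) (M *v u)"

text \<open>The invariant of the iteration: the fixed bounds l and L survive every step, whereas the
  extremal eigenvalues move.\<close>

definition form_between :: "real \<Rightarrow> real \<Rightarrow> real ^ 'n ^ 'n \<Rightarrow> bool" where
  "form_between l L M \<longleftrightarrow>
     transpose M = M \<and> (\<forall>x. l * (norm x)\<^sup>2 \<le> qform M x \<and> qform M x \<le> L * (norm x)\<^sup>2)"

lemma outer_mult_vec: "outer u w *v x = (w \<bullet> x) *\<^sub>R u"
  by (simp add: outer_def vec_eq_iff matrix_vector_mult_def inner_vec_def sum_distrib_left mult_ac)

lemma scaleR_matrix_vec: "(c *\<^sub>R M) *v x = c *\<^sub>R (M *v (x::real^'n))"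
  by (simp add: vec_eq_iff matrix_vector_mult_def sum_distrib_left mult_ac)

lemma sstep_mult_vec:
  "sstep M u *v x = M *v x + (qform M u * (u \<bullet> x)) *\<^sub>R u
     - ((M *v u) \<bullet> x / qform M u) *\<^sub>R (M *v u)"
  by (simp add: sstep_def matrix_vector_mult_diff_rdistrib matrix_vector_mult_add_rdistrib
      scaleR_matrix_vec outer_mult_vec)

lemma sym_inner_swap:
  fixes M :: "real ^ 'n ^ 'n"
  assumes "transpose M = M"
  shows "x \<bullet> (M *v y) = y \<bullet> (M *v x)"
  by (metis assms dot_lmul_matrix inner_commute transpose_matrix_vector)

lemma transpose_sstep: "transpose M = M \<Longrightarrow> transpose (sstep M u) = sstep M u"
  by (simp add: sstep_def transpose_def vec_eq_iff outer_def mult_ac)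

lemma qform_sstep:
  "qform (sstep M u) x = qform M x + (u \<bullet> x)\<^sup>2 * qform M u - (x \<bullet> (M *v u))\<^sup>2 / qform M u"
  unfolding qform_def[of "sstep M u"] sstep_mult_vec
  by (simp add: inner_diff_right inner_add_right power2_eq_square inner_commute)
     (simp add: qform_def mult_ac)

lemma qform_line:
  assumes "transpose M = M"
  shows "qform M (x + t *\<^sub>R u) = qform M x + 2 * t * (x \<bullet> (M *v u)) + t\<^sup>2 * qform M u"
  using sym_inner_swap[OF assms, of u x]
  by (simp add: qform_def matrix_vector_right_distrib inner_add_left inner_add_right
      scaleR_matrix_vec matrix_vector_mult_scaleR power2_eq_square algebra_simps)

lemma qform_scale: "qform M (t *\<^sub>R x) = t\<^sup>2 * qform M x"
  by (simp add: qform_def matrix_vector_mult_scaleR power2_eq_square)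

lemma form_between_pos:
  assumes "form_between l L M" "0 < l" "x \<noteq> 0"
  shows "0 < qform M x"
proof -
  have "0 < l * (norm x)\<^sup>2" using assms by simp
  then show ?thesis using assms unfolding form_between_def by (meson less_le_trans)
qed

lemma form_between_nonneg:
  assumes "form_between l L M" "0 < l"
  shows "0 \<le> qform M x"
  using form_between_pos[OF assms, of x] by (cases "x = 0") (auto simp: qform_def)

text \<open>The new form has no mixed term between u and its complement. On the complement it is,
  for a > 0, the minimum over t of the old form at \<xi> + t u.\<close>

lemma qform_sstep_orthogonal_decomp:
  assumes "transpose M = M" "norm u = 1" "qform M u \<noteq> 0"
  defines "\<xi> \<equiv> \<lambda>x. x - (x \<bullet> u) *\<^sub>R u"
  shows "qform (sstep M u) x = qform M (\<xi> x) - (\<xi> x \<bullet> (M *v u))\<^sup>2 / qform M u + (x \<bullet> u)\<^sup>2 * qform M u"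
proof -
  let ?a = "qform M u" and ?s = "x \<bullet> u" and ?m = "x \<bullet> (M *v u)"
  have 1: "qform M (\<xi> x) = qform M x - 2 * ?s * ?m + ?s\<^sup>2 * ?a"
    using qform_line[OF assms(1), of x "- ?s" u] by (simp add: \<xi>_def)
  have 2: "\<xi> x \<bullet> (M *v u) = ?m - ?s * ?a"
    by (simp add: \<xi>_def inner_diff_left qform_def)
  show ?thesis unfolding 1 2 qform_sstep using assms(3)
    by (simp add: inner_commute[of u x] field_simps power2_eq_square)
qed

lemma norm_orthogonal_decomp:
  fixes u x :: "'a::real_inner"
  assumes "norm u = 1"
  shows "(norm x)\<^sup>2 = (norm (x - (x \<bullet> u) *\<^sub>R u))\<^sup>2 + (x \<bullet> u)\<^sup>2"
proof -
  have "u \<bullet> u = 1" using assms by (simp add: dot_square_norm)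
  then show ?thesis
    unfolding power2_norm_eq_inner
    by (simp add: inner_diff_left inner_diff_right inner_commute power2_eq_square)
qed

text \<open>Minimizing along u preserves both bounds on the complement of u, and the value a on u
  itself already lies between them.\<close>

lemma form_between_sstep:
  assumes M: "form_between l L M" and l: "0 < l" and u: "norm u = 1"
  shows "form_between l L (sstep M u)"
proof -
  have sym: "transpose M = M" using M by (simp add: form_between_def)
  have a: "0 < qform M u" using form_between_pos[OF M l, of u] u by force
  have b: "l * (norm y)\<^sup>2 \<le> qform M y" "qform M y \<le> L * (norm y)\<^sup>2" for y
    using M by (auto simp: form_between_def)
  have "l * (norm x)\<^sup>2 \<le> qform (sstep M u) x \<and> qform (sstep M u) x \<le> L * (norm x)\<^sup>2" for x
  proof -
    define y where "y = x - (x \<bullet> u) *\<^sub>R u"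
    define s where "s = x \<bullet> u"
    define m where "m = y \<bullet> (M *v u)"
    have eq: "qform (sstep M u) x = qform M y - m\<^sup>2 / qform M u + s\<^sup>2 * qform M u"
      using qform_sstep_orthogonal_decomp[OF sym u] a by (simp add: y_def s_def m_def)
    have n: "(norm x)\<^sup>2 = (norm y)\<^sup>2 + s\<^sup>2"
      unfolding y_def s_def using u by (rule norm_orthogonal_decomp)
    have orth: "y \<bullet> u = 0"
      using u by (simp add: y_def inner_diff_left dot_square_norm)
    have "(norm (y + k *\<^sub>R u))\<^sup>2 = (norm y)\<^sup>2 + k\<^sup>2 * (norm u)\<^sup>2" for k
      unfolding power2_norm_eq_inner using orth
      by (simp add: inner_add_left inner_add_right inner_commute power2_eq_square)
    \<comment> \<open>The minimizer on the line is y - (m/a) u. It is at least as long as y, so the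
      lower bound at the minimizer passes to y.\<close>
    then have "l * (norm y)\<^sup>2 \<le> l * (norm (y + (- m / qform M u) *\<^sub>R u))\<^sup>2"
      using l by (intro mult_left_mono) (simp_all only: less_imp_le, simp)
    also have "\<dots> \<le> qform M (y + (- m / qform M u) *\<^sub>R u)" by (rule b)
    also have "\<dots> = qform M y - m\<^sup>2 / qform M u"
      unfolding qform_line[OF sym] using a by (simp add: m_def[symmetric] field_simps power2_eq_square)
    finally have 1: "l * (norm y)\<^sup>2 \<le> qform M y - m\<^sup>2 / qform M u" .
    have 2: "l \<le> qform M u" "qform M u \<le> L" using b[of u] u by auto
    have 3: "s\<^sup>2 * l \<le> s\<^sup>2 * qform M u" "s\<^sup>2 * qform M u \<le> s\<^sup>2 * L"
      using 2 by (auto intro: mult_left_mono)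
    have "0 \<le> m\<^sup>2 / qform M u" using a by simp
    then show ?thesis unfolding eq n using 1 3 b(2)[of y] by (simp add: algebra_simps)
  qed
  then show ?thesis using transpose_sstep[OF sym] by (auto simp: form_between_def)
qed

lemma trace_eq_qform: "trace M = (\<Sum>i\<in>UNIV. qform M (axis i 1))"
  by (simp add: trace_def qform_def matrix_vector_mult_basis column_def inner_axis' )

text \<open>The trace changes by a - |Mu|^2 / a, which is nonpositive because a = <u, Mu> \<le> |Mu|
  by Cauchy-Schwarz.\<close>

lemma trace_sstep_le:
  assumes M: "form_between l L M" and l: "0 < l" and u: "norm u = 1"
  shows "trace (sstep M u) \<le> trace M"
proof -
  let ?a = "qform M u"
  have a: "0 < ?a" using form_between_pos[OF M l, of u] u by force
  have t: "trace (outer v v) = (norm v)\<^sup>2" for v :: "real^'n"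
    by (simp add: trace_def outer_def power2_norm_eq_inner inner_vec_def)
  have "trace (sstep M u) = trace M + ?a * trace (outer u u) - (1 / ?a) * trace (outer (M *v u) (M *v u))"
    by (simp add: sstep_def trace_def sum.distrib sum_subtractf sum_distrib_left)
  also have "\<dots> = trace M + (?a - (norm (M *v u))\<^sup>2 / ?a)"
    using u by (simp add: t)
  also have "\<dots> \<le> trace M"
  proof -
    have "?a \<le> norm u * norm (M *v u)" unfolding qform_def by (rule norm_cauchy_schwarz)
    then have "?a\<^sup>2 \<le> (norm (M *v u))\<^sup>2" using u a by (intro power_mono) auto
    then show ?thesis using a by (simp add: field_simps power2_eq_square)
  qed
  finally show ?thesis .
qed

lemma sstep_direction: 
  assumes "norm u = 1" "qform M u \<noteq> 0"
  shows "sstep M u *v u = qform M u *\<^sub>R u"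
proof -
  have "u \<bullet> u = 1" "(M *v u) \<bullet> u = qform M u"
    using assms by (simp_all add: dot_square_norm qform_def inner_commute)
  then show ?thesis using assms by (simp add: sstep_mult_vec)
qed

section \<open>Extremal eigenvalues and their eigenvectors\<close>

text \<open>First variation: M - c is nonnegative and vanishes at v, so moving v in the direction z
  = Mv - cv cannot make it negative. For nonzero z and small negative t the linear term 2 t |z|^2
  would do so.\<close>

lemma extremal_vector_eigen:
  fixes M :: "real ^ 'n ^ 'n"
  assumes sym: "transpose M = M" and le: "\<And>x. c * (norm x)\<^sup>2 \<le> qform M x" and eq: "qform M v = c * (norm v)\<^sup>2"
  shows "M *v v = c *\<^sub>R v"
proof -
  define z where "z = M *v v - c *\<^sub>R v"
  have key: "0 \<le> 2 * t * (norm z)\<^sup>2 + t\<^sup>2 * (qform M z - c * (norm z)\<^sup>2)" for t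
  proof -
    have "c * (norm (v + t *\<^sub>R z))\<^sup>2 \<le> qform M (v + t *\<^sub>R z)" by (rule le)
    moreover have "(norm (v + t *\<^sub>R z))\<^sup>2 = (norm v)\<^sup>2 + 2 * t * (z \<bullet> v) + t\<^sup>2 * (norm z)\<^sup>2"
      unfolding power2_norm_eq_inner
      by (simp add: inner_add_left inner_add_right inner_commute[of v z] power2_eq_square
          algebra_simps)
    moreover have "(norm z)\<^sup>2 = z \<bullet> (M *v v) - c * (z \<bullet> v)"
      unfolding power2_norm_eq_inner by (subst (2) z_def) (simp add: inner_diff_right)
    ultimately have "c * ((norm v)\<^sup>2 + 2 * t * (z \<bullet> v) + t\<^sup>2 * (norm z)\<^sup>2)
        \<le> c * (norm v)\<^sup>2 + 2 * t * ((norm z)\<^sup>2 + c * (z \<bullet> v)) + t\<^sup>2 * qform M z"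
      using qform_line[OF sym, of v t z] sym_inner_swap[OF sym, of v z] eq by simp
    then show ?thesis by (simp add: algebra_simps)
  qed
  define B where "B = qform M z - c * (norm z)\<^sup>2"
  have B: "0 \<le> B" using le by (simp add: B_def)
  have "norm z = 0"
  proof (rule ccontr)
    assume "norm z \<noteq> 0"
    then have z: "0 < (norm z)\<^sup>2" by simp
    \<comment> \<open>The denominator B + 1 is positive even for B = 0, and t^2 (B + 1) cancels
      exactly half of the linear term.\<close>
    define t where "t = - (norm z)\<^sup>2 / (B + 1)"
    have t: "t < 0" "t * (B + 1) = - (norm z)\<^sup>2"
      using z B by (auto simp: t_def divide_neg_pos)
    have "0 \<le> 2 * t * (norm z)\<^sup>2 + t\<^sup>2 * B" using key B_def by simp
    also have "\<dots> \<le> 2 * t * (norm z)\<^sup>2 + t * (t * (B + 1))"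
      by (simp add: power2_eq_square algebra_simps)
    also have "\<dots> = t * (norm z)\<^sup>2" unfolding t(2) by (simp add: algebra_simps)
    also have "\<dots> < 0" using t(1) z by (rule mult_neg_pos)
    finally show False by simp
  qed
  then show ?thesis by (simp add: z_def)
qed

lemma continuous_on_qform: "continuous_on S (qform M)"
  unfolding qform_def by (intro continuous_intros linear_continuous_on) simp

lemma uminus_matrix_vec: "(- M) *v x = - (M *v (x::real^'n))"
  by (simp add: vec_eq_iff matrix_vector_mult_def sum_negf)

lemma qform_uminus: "qform (- M) x = - qform M x"
  by (simp add: qform_def uminus_matrix_vec)

lemma minimal_eigenvector:
  fixes M :: "real ^ 'n ^ 'n"
  assumes sym: "transpose M = M"
  obtains v c where "norm v = 1" "M *v v = c *\<^sub>R v" "qform M v = c"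
    "\<And>x. c * (norm x)\<^sup>2 \<le> qform M x"
proof -
  have "sphere (0::real^'n) 1 \<noteq> {}" by simp
  then obtain v where v: "v \<in> sphere 0 1" "\<And>x. x \<in> sphere 0 1 \<Longrightarrow> qform M v \<le> qform M x"
    using continuous_attains_inf[OF compact_sphere _ continuous_on_qform] by metis
  have le: "qform M v * (norm x)\<^sup>2 \<le> qform M x" for x
  proof (cases "x = 0")
    case False
    have "qform M v * (norm x)\<^sup>2 \<le> qform M (x /\<^sub>R norm x) * (norm x)\<^sup>2"
      using False by (intro mult_right_mono v(2)) auto
    also have "\<dots> = qform M x" using False by (simp add: qform_scale field_simps)
    finally show ?thesis .
  qed (simp add: qform_def)
  show thesis using v le by (intro that[of v "qform M v"] extremal_vector_eigen[OF sym]) auto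
qed

lemma maximal_eigenvector:
  fixes M :: "real ^ 'n ^ 'n"
  assumes sym: "transpose M = M"
  obtains v c where "norm v = 1" "M *v v = c *\<^sub>R v" "qform M v = c"
    "\<And>x. qform M x \<le> c * (norm x)\<^sup>2"
proof -
  have "transpose (- M) = - M" using sym by (simp add: transpose_def vec_eq_iff)
  then obtain v c where v: "norm v = 1" "(- M) *v v = c *\<^sub>R v" "qform (- M) v = c"
    "\<And>x. c * (norm x)\<^sup>2 \<le> qform (- M) x" using minimal_eigenvector by metis
  show thesis
  proof (rule that[of v "- c"])
    show "M *v v = - c *\<^sub>R v" using v(2) by (metis minus_minus scaleR_minus_left uminus_matrix_vec)
    show "qform M v = - c" using v(3) by (simp add: qform_uminus)
    show "qform M x \<le> - c * (norm x)\<^sup>2" for x using v(4)[of x] by (simp add: qform_uminus)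
  qed (rule v)
qed

lemma maximal_eigenvector_of:
  fixes M :: "real ^ 'n ^ 'n"
  assumes sym: "transpose M = M" and le: "\<And>x. qform M x \<le> c * (norm x)\<^sup>2" and eq: "qform M v = c * (norm v)\<^sup>2"
  shows "M *v v = c *\<^sub>R v"
proof -
  have "transpose (- M) = - M" using sym by (simp add: transpose_def vec_eq_iff)
  then have "(- M) *v v = (- c) *\<^sub>R v"
    using le eq by (intro extremal_vector_eigen) (auto simp: qform_uminus)
  then show ?thesis by (simp add: uminus_matrix_vec)
qed

text \<open>Eigenvectors for distinct eigenvalues are orthogonal, hence independent. Finiteness
  gives \<open>Max\<close> and \<open>Min\<close> in \<open>lambda_max\<close> and
  \<open>lambda_min\<close> their meaning.\<close>

lemma finite_eigenvalues:
  fixes M :: "real ^ 'n ^ 'n"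
  assumes sym: "transpose M = M"
  shows "finite (eigenvalues M)"
proof -
  have "\<forall>l\<in>eigenvalues M. \<exists>v. v \<noteq> 0 \<and> M *v v = l *\<^sub>R v" by (simp add: eigenvalues_def)
  then obtain e where e: "\<And>l. l \<in> eigenvalues M \<Longrightarrow> e l \<noteq> 0 \<and> M *v e l = l *\<^sub>R e l" by metis
  have orth: "e k \<bullet> e l = 0" if "k \<in> eigenvalues M" "l \<in> eigenvalues M" "k \<noteq> l" for k l
  proof -
    have "l * (e k \<bullet> e l) = k * (e k \<bullet> e l)"
      using sym_inner_swap[OF sym, of "e k" "e l"] e that by (simp add: inner_commute)
    then show ?thesis using that by simp
  qed
  have inj: "inj_on e (eigenvalues M)"
    using orth e by (metis inj_onI inner_eq_zero_iff)
  have "pairwise orthogonal (e ` eigenvalues M)" "0 \<notin> e ` eigenvalues M"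
    using orth e by (auto simp: pairwise_def orthogonal_def)
  then have "finite (e ` eigenvalues M)"
    using pairwise_orthogonal_independent independent_imp_finite by blast
  then show ?thesis using inj finite_imageD by blast
qed

lemma lambda_max_eq:
  fixes M :: "real ^ 'n ^ 'n"
  assumes sym: "transpose M = M" and "norm v = 1" "M *v v = c *\<^sub>R v" "\<And>x. qform M x \<le> c * (norm x)\<^sup>2"
  shows "lambda_max M = c"
  unfolding lambda_max_def
proof (rule Max_eqI[OF finite_eigenvalues[OF sym]])
  show "c \<in> eigenvalues M" using assms by (auto simp: eigenvalues_def intro!: exI[of _ v])
  fix l assume "l \<in> eigenvalues M"
  then obtain w where "w \<noteq> 0" "M *v w = l *\<^sub>R w" by (auto simp: eigenvalues_def)
  then show "l \<le> c" using assms(4)[of w] by (simp add: qform_def dot_square_norm)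
qed

lemma lambda_min_eq:
  fixes M :: "real ^ 'n ^ 'n"
  assumes sym: "transpose M = M" and "norm v = 1" "M *v v = c *\<^sub>R v" "\<And>x. c * (norm x)\<^sup>2 \<le> qform M x"
  shows "lambda_min M = c"
  unfolding lambda_min_def
proof (rule Min_eqI[OF finite_eigenvalues[OF sym]])
  show "c \<in> eigenvalues M" using assms by (auto simp: eigenvalues_def intro!: exI[of _ v])
  fix l assume "l \<in> eigenvalues M"
  then obtain w where "w \<noteq> 0" "M *v w = l *\<^sub>R w" by (auto simp: eigenvalues_def)
  then show "c \<le> l" using assms(4)[of w] by (simp add: qform_def dot_square_norm)
qed

lemma form_between_lambda:
  fixes M :: "real ^ 'n ^ 'n"
  assumes "symmetric_posdef M"
  shows "form_between (lambda_min M) (lambda_max M) M" "0 < lambda_min M"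
    "\<exists>v. norm v = 1 \<and> qform M v = lambda_max M" "\<exists>v. norm v = 1 \<and> qform M v = lambda_min M"
proof -
  have sym: "transpose M = M" using assms by (simp add: symmetric_posdef_def)
  obtain v c where v: "norm v = 1" "M *v v = c *\<^sub>R v" "qform M v = c" "\<And>x. c * (norm x)\<^sup>2 \<le> qform M x"
    using minimal_eigenvector[OF sym] by metis
  obtain w C where w: "norm w = 1" "M *v w = C *\<^sub>R w" "qform M w = C" "\<And>x. qform M x \<le> C * (norm x)\<^sup>2"
    using maximal_eigenvector[OF sym] by metis
  have eq: "lambda_min M = c" "lambda_max M = C"
    using lambda_min_eq[OF sym v(1,2,4)] lambda_max_eq[OF sym w(1,2,4)] by auto
  show "form_between (lambda_min M) (lambda_max M) M"
    using sym v(4) w(4) by (simp add: form_between_def eq)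
  have "v \<noteq> 0" using v(1) by auto
  then have "0 < qform M v" using assms by (simp add: symmetric_posdef_def qform_def)
  then show "0 < lambda_min M" using v(3) by (simp add: eq)
  show "\<exists>v. norm v = 1 \<and> qform M v = lambda_max M" "\<exists>v. norm v = 1 \<and> qform M v = lambda_min M"
    using v w eq by auto
qed

text \<open>In u = z + s v with z orthogonal to the eigenvector v the mixed term vanishes, so the
  form is the sum of its values at z and at s v.\<close>

lemma qform_ge_eigen:
  assumes sym: "transpose M = M" and v: "norm v = 1" "M *v v = c *\<^sub>R v" and u: "norm u = 1"
    and le: "\<And>x. k * (norm x)\<^sup>2 \<le> qform M x"
  shows "k + (c - k) * (v \<bullet> u)\<^sup>2 \<le> qform M u"
proof -
  define s where "s = u \<bullet> v"
  define z where "z = u - s *\<^sub>R v"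
  have z: "z \<bullet> v = 0" using v by (simp add: z_def s_def inner_diff_left dot_square_norm)
  have n: "(norm z)\<^sup>2 = 1 - s\<^sup>2"
    using norm_orthogonal_decomp[OF v(1), of u] u by (simp add: z_def s_def)
  have "qform M u = qform M (z + s *\<^sub>R v)" by (simp add: z_def)
  also have "\<dots> = qform M z + s\<^sup>2 * c"
    unfolding qform_line[OF sym] using v z by (simp add: qform_def dot_square_norm)
  also have "\<dots> \<ge> k * (1 - s\<^sup>2) + s\<^sup>2 * c" using le[of z] n by simp
  finally show ?thesis by (simp add: s_def inner_commute algebra_simps)
qed

lemma qform_le_eigen:
  assumes sym: "transpose M = M" and v: "norm v = 1" "M *v v = c *\<^sub>R v" and u: "norm u = 1"
    and le: "\<And>x. qform M x \<le> k * (norm x)\<^sup>2"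
  shows "qform M u \<le> k - (k - c) * (v \<bullet> u)\<^sup>2"
proof -
  have "transpose (- M) = - M" using sym by (simp add: transpose_def vec_eq_iff)
  then have "- k + (- c - - k) * (v \<bullet> u)\<^sup>2 \<le> qform (- M) u"
    using v u le by (intro qform_ge_eigen) (auto simp: qform_uminus uminus_matrix_vec)
  then show ?thesis by (simp add: qform_uminus algebra_simps)
qed

lemma qform_sstep_eigen:
  assumes sym: "transpose M = M" and v: "norm v = 1" "M *v v = c *\<^sub>R v"
  shows "qform (sstep M u) v = c + (v \<bullet> u)\<^sup>2 * (qform M u - c\<^sup>2 / qform M u)"
proof -
  have "v \<bullet> (M *v u) = c * (v \<bullet> u)"
    using sym_inner_swap[OF sym, of v u] v(2) by (simp add: inner_commute)
  moreover have "qform M v = c" using v by (simp add: qform_def dot_square_norm)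
  ultimately show ?thesis
    by (simp add: qform_sstep inner_commute[of u v] power_mult_distrib algebra_simps)
qed

section \<open>Rearrangements of truncated quadratic forms\<close>

definition bump :: "real ^ 'n ^ 'n \<Rightarrow> real ^ 'n \<Rightarrow> real" where
  "bump M x = max (1 - qform M x) 0"

lemma sym_ball_eqI:
  fixes A :: "'a::euclidean_space set"
  assumes "emeasure lebesgue A < \<infinity>" "emeasure lebesgue (ball (0::'a) r) = emeasure lebesgue A"
  shows "sym_ball A = ball 0 r"
  unfolding sym_ball_def using sym_ball_unique[OF assms(1)] assms(2) by (intro the1_equality) auto

text \<open>The \<open>max 0\<close> makes the radius 0, hence the ball empty, at the levels t \<ge>
  c.\<close>

lemma cap_level_set:
  fixes a c t :: real
  assumes "0 < a" "0 < t"
  shows "{x::'a::real_normed_vector. max (c - a * (norm x)\<^sup>2) 0 > t} = ball 0 (sqrt (max 0 ((c - t) / a)))"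
proof -
  define k where "k = (c - t) / a"
  have "max (c - a * (norm x)\<^sup>2) 0 > t \<longleftrightarrow> norm x < sqrt (max 0 k)" for x :: 'a
  proof -
    have "max (c - a * (norm x)\<^sup>2) 0 > t \<longleftrightarrow> c - a * (norm x)\<^sup>2 > t"
      using assms(2) by linarith
    also have "\<dots> \<longleftrightarrow> (norm x)\<^sup>2 < k"
      using assms(1) by (simp add: k_def pos_less_divide_eq mult.commute less_diff_eq diff_less_eq add.commute)
    also have "\<dots> \<longleftrightarrow> (norm x)\<^sup>2 < max 0 k"
      using zero_le_power2[of "norm x"] by linarith
    also have "\<dots> \<longleftrightarrow> sqrt ((norm x)\<^sup>2) < sqrt (max 0 k)"
      by (rule real_sqrt_less_iff[symmetric])
    finally show ?thesis by simp
  qed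
  then show ?thesis by (simp add: set_eq_iff k_def)
qed

text \<open>The level sets are balls around z whose radius does not depend on z, so centering them
  removes the translation. On \<open>real\<close> this treats one line of a Steiner symmetrization;
  for z = 0 it shows that a centered cap is its own rearrangement.\<close>

lemma rearrangement_translated_cap:
  fixes a c :: real and z :: "'a::euclidean_space"
  assumes a: "0 < a"
  shows "rearrangement (\<lambda>x. max (c - a * (norm (x - z))\<^sup>2) 0) = (\<lambda>x. max (c - a * (norm x)\<^sup>2) 0)"
    (is "rearrangement ?f = ?g")
proof -
  have lev: "{x. ?f x > t} = ball z (sqrt (max 0 ((c - t) / a)))" if "t > 0" for t
  proof -
    have "{x. ?f x > t} = {x. x - z \<in> {y. ?g y > t}}" by simp
    also have "\<dots> = ball z (sqrt (max 0 ((c - t) / a)))"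
      unfolding cap_level_set[OF a that] by (simp add: set_eq_iff dist_norm norm_minus_commute)
    finally show ?thesis .
  qed
  have eq: "{x. ?g x > t} = sym_ball {x. ?f x > t}" if "t > 0" for t
    unfolding cap_level_set[OF a that] lev[OF that]
    by (rule sym_ball_eqI[symmetric]) (auto simp: emeasure_ball)
  have "is_rearrangement ?f ?g"
    unfolding is_rearrangement_def
  proof (intro conjI allI impI)
    show "lower_semicont ?g" unfolding lower_semicont_def
      by (intro allI open_Collect_less continuous_intros)
    show "radially_decreasing ?g" unfolding radially_decreasing_def
    proof (intro allI impI)
      fix x y :: 'a
      assume "norm x \<le> norm y"
      then have "a * (norm x)\<^sup>2 \<le> a * (norm y)\<^sup>2" using a by (intro mult_left_mono power_mono) auto
      then show "?g y \<le> ?g x" by (intro max.mono) auto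
    qed
  qed (use eq in auto)
  moreover have "\<exists>!g. is_rearrangement ?f g"
  proof (rule rearrangement_ex1)
    show "?f x \<le> max c 0" for x using a by (intro max.mono) auto
  qed (auto simp: lev emeasure_ball)
  ultimately show ?thesis unfolding rearrangement_def by (rule the1_equality[rotated])
qed

lemma steiner_bump:
  fixes M :: "real ^ 'n ^ 'n"
  assumes M: "form_between l L M" and l: "0 < l" and u: "norm u = 1"
  shows "steiner u (bump M) = bump (sstep M u)"
proof
  fix x
  have sym: "transpose M = M" using M by (simp add: form_between_def)
  define a where "a = qform M u"
  have a: "0 < a" unfolding a_def using form_between_pos[OF M l, of u] u by force
  define y where "y = x - (x \<bullet> u) *\<^sub>R u"
  define m where "m = y \<bullet> (M *v u)"
  \<comment> \<open>On the line y + t u the form is a parabola in t with vertex at -m/a, and c is 1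
    minus its minimum, the height of the cap.\<close>
  define c where "c = 1 - qform M y + m\<^sup>2 / a"
  have "bump M (y + t *\<^sub>R u) = max (c - a * (norm (t - (- m / a)))\<^sup>2) 0" for t
  proof -
    have "a * (t + m / a)\<^sup>2 = t\<^sup>2 * a + 2 * t * m + m\<^sup>2 / a"
      using a by (simp add: field_simps power2_eq_square)
    then show ?thesis unfolding bump_def qform_line[OF sym]
      by (simp add: c_def m_def[symmetric] a_def[symmetric])
  qed
  then have "steiner u (bump M) x = max (c - a * (norm (x \<bullet> u))\<^sup>2) 0"
    unfolding steiner_def y_def[symmetric] by (simp only: rearrangement_translated_cap[OF a])
  also have "\<dots> = bump (sstep M u) x"
    using qform_sstep_orthogonal_decomp[OF sym u, of x] a
    by (simp add: bump_def c_def m_def y_def a_def algebra_simps)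
  finally show "steiner u (bump M) x = bump (sstep M u) x" .
qed

primrec sstep_seq :: "(nat \<Rightarrow> real ^ 'n) \<Rightarrow> nat \<Rightarrow> real ^ 'n ^ 'n \<Rightarrow> real ^ 'n ^ 'n" where
  "sstep_seq u 0 M = M"
| "sstep_seq u (Suc n) M = sstep (sstep_seq u n M) (u (Suc n))"

lemma form_between_sstep_seq:
  assumes "form_between l L M" "0 < l" "\<And>i. i \<ge> 1 \<Longrightarrow> norm (u i) = 1"
  shows "form_between l L (sstep_seq u n M)"
  by (induction n) (auto intro!: form_between_sstep assms)

lemma steiner_seq_bump:
  assumes "form_between l L M" "0 < l" "\<And>i. i \<ge> 1 \<Longrightarrow> norm (u i) = 1"
  shows "steiner_seq u n (bump M) = bump (sstep_seq u n M)"
  by (induction n) (auto intro!: steiner_bump form_between_sstep_seq assms)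

text \<open>Larger functions have level sets of larger measure, and centered balls are ordered by
  measure. A level t strictly between two wrongly ordered values gives the contradiction.\<close>

lemma rearrangement_mono:
  assumes f: "is_rearrangement f f'" and g: "is_rearrangement g g'"
    and fin: "\<And>t. t > 0 \<Longrightarrow> emeasure lebesgue {x. g x > t} < \<infinity>"
    and meas: "\<And>t. t > 0 \<Longrightarrow> {x. g x > t} \<in> sets lebesgue"
    and le: "\<And>x. f x \<le> g x"
  shows "f' x \<le> g' x"
proof (rule ccontr)
  assume "\<not> f' x \<le> g' x"
  then obtain t where t: "g' x < t" "t < f' x" using dense by (meson not_le)
  then have t0: "t > 0" using g by (meson is_rearrangement_def le_less_trans)
  have le: "emeasure lebesgue {x. f x > t} \<le> emeasure lebesgue {x. g x > t}"
    using le meas[OF t0] by (intro emeasure_mono) (auto intro: less_le_trans)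
  then have fin': "emeasure lebesgue {x. f x > t} < \<infinity>" using fin[OF t0] by (rule le_less_trans)
  have "x \<in> sym_ball {x. f x > t}" using f t t0 by (auto simp: is_rearrangement_def)
  then have "x \<in> sym_ball {x. g x > t}"
    unfolding mem_sym_ball_iff[OF fin'] mem_sym_ball_iff[OF fin[OF t0]] using le by (rule less_le_trans)
  also have "sym_ball {x. g x > t} = {x. g' x > t}"
    using g t0 by (simp add: is_rearrangement_def)
  finally show False using t by simp
qed

text \<open>The function is squeezed between two centered caps, which are their own rearrangements,
  and rearranging is monotone.\<close>

lemma rearrangement_bump:
  fixes M :: "real ^ 'n ^ 'n"
  assumes M: "form_between l L M" and l: "0 < l"
  shows "max (1 - L * (norm x)\<^sup>2) 0 \<le> rearrangement (bump M) x"
    and "rearrangement (bump M) x \<le> max (1 - l * (norm x)\<^sup>2) 0"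
    and "norm x = norm y \<Longrightarrow> rearrangement (bump M) x = rearrangement (bump M) y"
proof -
  let ?cap = "\<lambda>k. \<lambda>x::real^'n. max (1 - k * (norm x)\<^sup>2) 0"
  have Q: "l * (norm x)\<^sup>2 \<le> qform M x" "qform M x \<le> L * (norm x)\<^sup>2" for x
    using M by (auto simp: form_between_def)
  have "l \<le> L" using Q[of "axis undefined 1"] by simp
  then have L: "0 < L" using l by simp
  have bnd: "?cap L x \<le> bump M x" "bump M x \<le> ?cap l x" for x
    using Q[of x] by (auto simp: bump_def)
  have capfin: "emeasure lebesgue {x. ?cap k x > t} < \<infinity>" "{x. ?cap k x > t} \<in> sets lebesgue"
    if "0 < k" "0 < t" for k t using that by (auto simp: cap_level_set emeasure_ball)
  have meas: "{x. bump M x > t} \<in> sets lebesgue" for t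
  proof -
    have "open {x. bump M x > t}" unfolding bump_def
      by (intro open_Collect_less continuous_intros continuous_on_qform)
    then show ?thesis by (simp add: borel_open sets_completionI_sets)
  qed
  have fin: "emeasure lebesgue {x. bump M x > t} < \<infinity>" if "t > 0" for t
  proof -
    have "emeasure lebesgue {x. bump M x > t} \<le> emeasure lebesgue {x. ?cap l x > t}"
      by (rule emeasure_mono[OF _ capfin(2)[OF l that]]) (use bnd(2) in \<open>auto intro: less_le_trans\<close>)
    then show ?thesis using capfin[OF l that] by (meson le_less_trans)
  qed
  have "\<exists>!g. is_rearrangement (bump M) g"
    by (rule rearrangement_ex1[where B = 1])
       (use meas fin form_between_nonneg[OF M l] in \<open>auto simp: bump_def\<close>)
  then have R: "is_rearrangement (bump M) (rearrangement (bump M))"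
    unfolding rearrangement_def by (rule theI')
  have C: "is_rearrangement (?cap k) (?cap k)" if k: "0 < k" for k
  proof -
    have "\<exists>!g. is_rearrangement (?cap k) g"
      by (rule rearrangement_ex1[where B = 1]) (use capfin[OF k] k in auto)
    then have "is_rearrangement (?cap k) (rearrangement (?cap k))"
      unfolding rearrangement_def by (rule theI')
    then show ?thesis using rearrangement_translated_cap[OF k, of 1 "0::real^'n"] by simp
  qed
  show "?cap L x \<le> rearrangement (bump M) x"
    by (rule rearrangement_mono[OF C[OF L] R fin meas bnd(1)])
  show "rearrangement (bump M) x \<le> ?cap l x"
    by (rule rearrangement_mono[OF R C[OF l] capfin[OF l] bnd(2)])
  show "norm x = norm y \<Longrightarrow> rearrangement (bump M) x = rearrangement (bump M) y"
    using R unfolding is_rearrangement_def radially_decreasing_def by (intro antisym) auto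
qed

section \<open>Moments of the uniform distribution on the sphere\<close>

text \<open>The invariance of the Lebesgue measure under orthogonal maps is available only for index types of
  class \<open>wellorder\<close>; every finite index type has a well-ordered copy.\<close>

typedef 'a ordered_copy = "UNIV :: 'a set" morphisms of_copy to_copy ..

instance ordered_copy :: (finite) finite
proof
  show "finite (UNIV :: 'a ordered_copy set)"
    by (rule finite_imageD[of of_copy]) (auto simp: inj_on_def of_copy_inject)
qed

definition copy_index :: "'a::finite ordered_copy \<Rightarrow> nat" where
  "copy_index = (SOME f. inj f)"

lemma inj_copy_index: "inj (copy_index :: 'a::finite ordered_copy \<Rightarrow> nat)"
proof -
  have "\<exists>f :: 'a ordered_copy \<Rightarrow> nat. inj f"
    using finite_imp_inj_to_nat_seg[of "UNIV :: 'a ordered_copy set"] by auto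
  then show ?thesis unfolding copy_index_def by (rule someI_ex)
qed

instantiation ordered_copy :: (finite) wellorder
begin

definition "x \<le> y \<longleftrightarrow> copy_index x \<le> copy_index y"
definition "x < y \<longleftrightarrow> copy_index x < copy_index y"

instance
proof
  fix x y z :: "'a ordered_copy"
  show "x < y \<longleftrightarrow> x \<le> y \<and> \<not> y \<le> x" "x \<le> x" "x \<le> y \<or> y \<le> x"
    unfolding less_eq_ordered_copy_def less_ordered_copy_def by linarith+
  show "x \<le> z" if "x \<le> y" "y \<le> z"
    using that unfolding less_eq_ordered_copy_def by (rule order_trans)
  show "x = y" if "x \<le> y" "y \<le> x"
    using that unfolding less_eq_ordered_copy_def by (intro injD[OF inj_copy_index]) (rule order_antisym)
next
  fix P :: "'a ordered_copy \<Rightarrow> bool" and a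
  assume *: "\<And>x. (\<And>y. y < x \<Longrightarrow> P y) \<Longrightarrow> P x"
  show "P a"
  proof (induction a rule: measure_induct_rule[of copy_index])
    case (less x)
    show ?case by (rule *) (simp add: less less_ordered_copy_def)
  qed
qed

end

section \<open>Rotation invariance of the uniform distribution\<close>

definition to_copy_vec :: "real ^ 'n \<Rightarrow> real ^ 'n ordered_copy" where
  "to_copy_vec x = (\<chi> i. x $ of_copy i)"

definition of_copy_vec :: "real ^ 'n ordered_copy \<Rightarrow> real ^ 'n" where
  "of_copy_vec x = (\<chi> i. x $ to_copy i)"

lemma bij_of_copy: "bij of_copy"
  by (rule bijI') (auto simp: of_copy_inject intro: to_copy_inverse[symmetric])

lemma copy_vec_inverse [simp]: "to_copy_vec (of_copy_vec x) = x" "of_copy_vec (to_copy_vec y) = y"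
  by (simp_all add: to_copy_vec_def of_copy_vec_def vec_eq_iff of_copy_inverse to_copy_inverse)

lemma linear_copy_vec: "linear to_copy_vec" "linear of_copy_vec"
  by (auto intro!: linearI simp: to_copy_vec_def of_copy_vec_def vec_eq_iff)

lemma inner_to_copy_vec: "to_copy_vec x \<bullet> to_copy_vec y = x \<bullet> y"
  unfolding inner_vec_def to_copy_vec_def
  using sum.reindex_bij_betw[OF bij_of_copy, of "\<lambda>i. x $ i * y $ i"] by simp

lemma inner_of_copy_vec: "of_copy_vec x \<bullet> of_copy_vec y = x \<bullet> y"
  using inner_to_copy_vec[of "of_copy_vec x" "of_copy_vec y"] by simp

lemma emeasure_lborel_box_cart:
  fixes l u :: "real ^ 'n"
  assumes "\<And>i. l $ i \<le> u $ i"
  shows "emeasure lborel (box l u) = (\<Prod>i\<in>UNIV. ennreal (u $ i - l $ i))"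
proof -
  have "emeasure lborel (box l u) = (\<Prod>b\<in>Basis. (u - l) \<bullet> b)"
    using assms by (intro emeasure_lborel_box) (auto simp: Basis_vec_def inner_axis)
  also have "(\<Prod>b\<in>Basis. (u - l) \<bullet> b) = (\<Prod>i\<in>UNIV. u $ i - l $ i)"
    by (simp add: Basis_vec_def cart_eq_inner_axis axis_eq_axis prod.UNION_disjoint inner_diff_left)
  finally show ?thesis using assms by (simp add: prod_ennreal)
qed

lemma linear_borel_measurable:
  fixes f :: "'a::euclidean_space \<Rightarrow> 'b::real_normed_vector"
  assumes "linear f"
  shows "f \<in> borel_measurable borel"
  by (rule borel_measurable_continuous_onI, rule linear_continuous_on)
     (use assms linear_conv_bounded_linear in blast)

text \<open>Relabelling coordinates carries boxes to boxes with the same side lengths, and boxes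
  determine Lebesgue measure.\<close>

lemma lborel_distr_of_copy_vec: "distr lborel borel of_copy_vec = (lborel :: (real ^ 'n) measure)"
proof (rule lborel_eqI[symmetric])
  fix l u :: "real ^ 'n"
  assume le: "\<And>b. b \<in> Basis \<Longrightarrow> l \<bullet> b \<le> u \<bullet> b"
  have le': "l $ i \<le> u $ i" for i using le[of "axis i 1"] by (simp add: inner_axis)
  have m: "(of_copy_vec :: real ^ 'n ordered_copy \<Rightarrow> real ^ 'n) \<in> borel_measurable borel"
    by (rule linear_borel_measurable[OF linear_copy_vec(2)])
  have "of_copy_vec -` box l u = box (to_copy_vec l) (to_copy_vec u)"
    by (auto simp: mem_box_cart of_copy_vec_def to_copy_vec_def) (metis of_copy_inverse to_copy_inverse UNIV_I)+
  then have "emeasure (distr lborel borel of_copy_vec) (box l u)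
      = emeasure lborel (box (to_copy_vec l) (to_copy_vec u))"
    using m by (simp add: emeasure_distr)
  also have "\<dots> = (\<Prod>i\<in>UNIV. ennreal (u $ of_copy i - l $ of_copy i))"
    using le' by (subst emeasure_lborel_box_cart) (simp_all add: to_copy_vec_def)
  also have "\<dots> = (\<Prod>i\<in>UNIV. ennreal (u $ i - l $ i))"
    by (rule prod.reindex_bij_betw[OF bij_of_copy])
  also have "\<dots> = emeasure lborel (box l u)"
    using le' by (rule emeasure_lborel_box_cart[symmetric])
  also have "\<dots> = (\<Prod>b\<in>Basis. (u - l) \<bullet> b)" using le by simp
  finally show "emeasure (distr lborel borel of_copy_vec) (box l u) = (\<Prod>b\<in>Basis. (u - l) \<bullet> b)" .
qed simp

text \<open>Such a map carries the uniform law of one ball to that of the other and commutes with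
  the radial projection. The two spaces may differ, so that relabelling of coordinates is
  covered.\<close>

lemma uniform_sphere_isometry:
  fixes T :: "'a::euclidean_space \<Rightarrow> 'b::euclidean_space"
  assumes lin: "linear T" and n: "\<And>x. norm (T x) = norm x" and T: "distr lborel borel T = lborel"
  shows "distr uniform_sphere borel T = uniform_sphere"
proof -
  let ?Ua = "uniform_measure lborel (ball (0::'a) 1)" and ?Ub = "uniform_measure lborel (ball (0::'b) 1)"
  have m [measurable]: "T \<in> borel_measurable borel"
    by (rule linear_borel_measurable[OF lin])
  have em: "emeasure lborel (T -` B) = emeasure lborel B" if "B \<in> sets borel" for B
  proof -
    have "emeasure lborel (T -` B) = emeasure (distr lborel borel T) B"
      using that by (simp add: emeasure_distr)
    then show ?thesis by (simp only: T)
  qed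
  have 1: "distr ?Ua borel T = ?Ub"
  proof (rule measure_eqI)
    fix A assume "A \<in> sets (distr ?Ua borel T)"
    then have A [measurable]: "A \<in> sets borel" by simp
    have TA: "T -` A \<in> sets borel" using measurable_sets[OF m A] by simp
    have "ball 0 1 \<inter> T -` A = T -` (ball 0 1 \<inter> A)" "ball (0::'a) 1 = T -` ball 0 1"
      using n by auto
    then have e: "emeasure lborel (ball 0 1 \<inter> T -` A) = emeasure lborel (ball 0 1 \<inter> A)"
      "emeasure lborel (ball (0::'a) 1) = emeasure lborel (ball (0::'b) 1)"
      using em[of "ball 0 1 \<inter> A"] em[of "ball 0 1"] by simp_all
    show "emeasure (distr ?Ua borel T) A = emeasure ?Ub A"
      using TA by (simp add: emeasure_distr e)
  qed simp
  have "T \<circ> (\<lambda>x. x /\<^sub>R norm x) = (\<lambda>x. x /\<^sub>R norm x) \<circ> T"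
    using n by (auto simp: linear_scale[OF lin])
  then have "distr uniform_sphere borel T = distr ?Ua borel ((\<lambda>x. x /\<^sub>R norm x) \<circ> T)"
    unfolding uniform_sphere_def by (subst distr_distr) auto
  also have "\<dots> = distr (distr ?Ua borel T) borel (\<lambda>x. x /\<^sub>R norm x)"
    by (subst distr_distr) auto
  finally show ?thesis unfolding 1 uniform_sphere_def .
qed

text \<open>Conjugating T by the relabelling gives an orthogonal map over the well-ordered copy,
  where \<open>uniform_sphere_orthogonal\<close> applies.\<close>

lemma uniform_sphere_rotation:
  fixes T :: "real ^ 'n \<Rightarrow> real ^ 'n"
  assumes T: "orthogonal_transformation T"
  shows "distr uniform_sphere borel T = uniform_sphere"
proof -
  let ?T = "to_copy_vec \<circ> T \<circ> of_copy_vec"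
  have lin: "linear T" using T by (rule orthogonal_transformation_linear)
  note meas = linear_borel_measurable
  have linT: "linear ?T" by (intro linear_compose lin linear_copy_vec)
  have orth: "orthogonal_transformation ?T"
    using T linT by (simp add: orthogonal_transformation_def inner_to_copy_vec inner_of_copy_vec)
  have copy: "distr uniform_sphere borel of_copy_vec = (uniform_sphere :: (real ^ 'n) measure)"
    by (rule uniform_sphere_isometry)
       (simp_all add: linear_copy_vec lborel_distr_of_copy_vec norm_eq_sqrt_inner inner_of_copy_vec)
  have "distr uniform_sphere borel T = distr (distr uniform_sphere borel of_copy_vec) borel T"
    by (simp only: copy)
  also have "\<dots> = distr uniform_sphere borel (T \<circ> of_copy_vec)"
    using meas[OF lin] meas[OF linear_copy_vec(2)] by (intro distr_distr) (auto simp: uniform_sphere_def)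
  also have "T \<circ> of_copy_vec = of_copy_vec \<circ> ?T" by (auto simp: fun_eq_iff)
  also have "distr uniform_sphere borel (of_copy_vec \<circ> ?T) = distr (distr uniform_sphere borel ?T) borel of_copy_vec"
    using meas[OF linT] meas[OF linear_copy_vec(2)]
    by (intro distr_distr[symmetric]) (auto simp: uniform_sphere_def)
  also have "\<dots> = uniform_sphere" unfolding uniform_sphere_orthogonal[OF orth] by (rule copy)
  finally show ?thesis .
qed

lemma sets_uniform_sphere [measurable_cong, simp]: "sets uniform_sphere = sets borel"
  by (simp add: uniform_sphere_def)

text \<open>Some rotation takes v to w, and the distribution is invariant under it.\<close>

lemma uniform_sphere_direction:
  fixes v w :: "real ^ 'n" and g :: "real \<Rightarrow> real"
  assumes "norm v = 1" "norm w = 1" and g [measurable]: "g \<in> borel_measurable borel"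
  shows "(\<integral>u. g (v \<bullet> u) \<partial>uniform_sphere) = (\<integral>u. g (w \<bullet> u) \<partial>uniform_sphere)"
proof -
  obtain T where T: "orthogonal_transformation T" "T v = w"
    using orthogonal_transformation_exists_1[OF assms(1,2)] by blast
  have [measurable]: "T \<in> borel_measurable borel"
    by (rule linear_borel_measurable[OF orthogonal_transformation_linear[OF T(1)]])
  have "(\<integral>u. g (w \<bullet> u) \<partial>uniform_sphere) = (\<integral>u. g (w \<bullet> u) \<partial>distr uniform_sphere borel T)"
    by (simp add: uniform_sphere_rotation[OF T(1)])
  also have "\<dots> = (\<integral>u. g (w \<bullet> T u) \<partial>uniform_sphere)"
    by (rule integral_distr) auto
  also have "\<dots> = (\<integral>u. g (v \<bullet> u) \<partial>uniform_sphere)"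
    using T by (metis orthogonal_transformation_def)
  finally show ?thesis by simp
qed

lemma integrable_uniform_sphere:
  fixes g :: "real ^ 'n \<Rightarrow> real"
  assumes g: "g \<in> borel_measurable borel" and bd: "\<And>u. norm u = 1 \<Longrightarrow> \<bar>g u\<bar> \<le> B"
  shows "integrable uniform_sphere g"
proof -
  interpret prob_space "uniform_sphere :: (real ^ 'n) measure" by (rule prob_space_uniform_sphere)
  have "AE u in uniform_sphere. norm (g u) \<le> B"
    using AE_uniform_sphere by eventually_elim (use bd in auto)
  then show ?thesis using g by (intro integrable_const_bound[of g B]) auto
qed

lemma integrable_uniform_sphere_cont:
  fixes g :: "real ^ 'n \<Rightarrow> real"
  assumes g: "continuous_on UNIV g"
  shows "integrable uniform_sphere g"
proof -
  have "compact (g ` sphere 0 1)"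
    by (rule compact_continuous_image[OF continuous_on_subset[OF g]]) auto
  then obtain B where "\<forall>x\<in>sphere 0 1. norm (g x) \<le> B"
    using compact_imp_bounded bounded_iff by (metis image_eqI)
  then show ?thesis
    using g by (intro integrable_uniform_sphere[of g B] borel_measurable_continuous_onI) auto
qed

section \<open>Second and fourth moments of a coordinate\<close>

text \<open>The squared coordinates sum to 1 almost everywhere, and their integrals agree by
  rotation invariance.\<close>

lemma uniform_sphere_second_moment:
  fixes v :: "real ^ 'n"
  assumes "norm v = 1"
  shows "(\<integral>u. (v \<bullet> u)\<^sup>2 \<partial>uniform_sphere) = 1 / CARD('n)"
proof -
  interpret prob_space "uniform_sphere :: (real ^ 'n) measure" by (rule prob_space_uniform_sphere)
  have "1 = (\<integral>u. (1::real) \<partial>(uniform_sphere :: (real ^ 'n) measure))" by (simp add: prob_space)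
  also have "\<dots> = (\<integral>u. (\<Sum>i\<in>UNIV. (axis i 1 \<bullet> u)\<^sup>2) \<partial>(uniform_sphere :: (real ^ 'n) measure))"
  proof (rule integral_cong_AE)
    show "AE u in (uniform_sphere :: (real ^ 'n) measure). 1 = (\<Sum>i\<in>UNIV. (axis i 1 \<bullet> u)\<^sup>2)"
      using AE_uniform_sphere
    proof eventually_elim
      case (elim u)
      then have "u \<bullet> u = 1" by (simp add: dot_square_norm)
      then have "(\<Sum>i\<in>UNIV. u $ i * u $ i) = 1" by (simp add: inner_vec_def)
      then show ?case by (simp add: inner_axis' power2_eq_square)
    qed
  qed measurable
  also have "\<dots> = (\<Sum>i\<in>UNIV. \<integral>u. (axis i 1 \<bullet> u)\<^sup>2 \<partial>(uniform_sphere :: (real ^ 'n) measure))"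
    by (intro Bochner_Integration.integral_sum integrable_uniform_sphere_cont continuous_intros)
  also have "\<dots> = (\<Sum>i\<in>(UNIV::'n set). \<integral>u. (v \<bullet> u)\<^sup>2 \<partial>uniform_sphere)"
    using assms by (intro sum.cong refl uniform_sphere_direction[of _ _ "\<lambda>x. x\<^sup>2"]) auto
  finally show ?thesis by (simp add: field_simps)
qed

text \<open>Integrate the square of the identity that the squared coordinates sum to 1. With pure
  moments m and mixed moments m/3 the result is d (d + 2) m / 3 = 1.\<close>

lemma uniform_sphere_fourth_moment:
  fixes v :: "real ^ 'n"
  assumes "norm v = 1"
  shows "(\<integral>u. (v \<bullet> u) ^ 4 \<partial>uniform_sphere) = 3 / (real CARD('n) * (real CARD('n) + 2))"
proof -
  interpret prob_space "uniform_sphere :: (real ^ 'n) measure" by (rule prob_space_uniform_sphere)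
  define m where "m = (\<integral>u. (v \<bullet> u) ^ 4 \<partial>uniform_sphere)"
  have m: "(\<integral>u. (w \<bullet> u) ^ 4 \<partial>uniform_sphere) = m" if "norm w = 1" for w :: "real ^ 'n"
    unfolding m_def using assms that by (intro uniform_sphere_direction[of _ _ "\<lambda>x. x ^ 4"]) auto
  have I: "integrable uniform_sphere (\<lambda>u::real^'n. (w \<bullet> u) ^ k * (z \<bullet> u) ^ j)" for w z k j
    by (intro integrable_uniform_sphere_cont continuous_intros)
  have mixed: "(\<integral>u. (axis i 1 \<bullet> u)\<^sup>2 * (axis j 1 \<bullet> u)\<^sup>2 \<partial>(uniform_sphere :: (real ^ 'n) measure)) = m / 3"
    if "i \<noteq> j" for i j :: 'n
  proof -
    let ?x = "\<lambda>u::real^'n. axis i 1 \<bullet> u" and ?y = "\<lambda>u::real^'n. axis j 1 \<bullet> u"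
    \<comment> \<open>rotating by 45 degrees in the plane of two axes relates the mixed to the pure fourth moment\<close>
    define p q :: "real^'n" where "p = (1 / sqrt 2) *\<^sub>R (axis i 1 + axis j 1)"
      and "q = (1 / sqrt 2) *\<^sub>R (axis i 1 - axis j 1)"
    have ij: "axis i (1::real) \<bullet> axis j (1::real) = 0" "axis j (1::real) \<bullet> axis i (1::real) = 0"
      "axis i (1::real) \<bullet> axis i (1::real) = 1" "axis j (1::real) \<bullet> axis j (1::real) = 1"
      using that by (simp_all add: inner_axis_axis)
    have n: "norm p = 1" "norm q = 1"
      unfolding norm_eq_1 p_def q_def by (simp_all add: ij inner_add_left inner_add_right inner_diff_left inner_diff_right)
    have s: "(sqrt 2) ^ 4 = (4::real)"
      using power_mult[of "sqrt 2" 2 2] by simp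
    have pq: "(p \<bullet> u) ^ 4 = (?x u + ?y u) ^ 4 / 4" "(q \<bullet> u) ^ 4 = (?x u - ?y u) ^ 4 / 4" for u
      by (simp_all add: p_def q_def inner_add_left inner_diff_left power_divide s)
    have id: "(p \<bullet> u) ^ 4 + (q \<bullet> u) ^ 4 = (?x u ^ 4 + ?y u ^ 4) / 2 + 3 * ((?x u)\<^sup>2 * (?y u)\<^sup>2)" for u
      unfolding pq by (simp add: field_simps power2_eq_square power4_eq_xxxx)
    have i1: "integrable uniform_sphere (\<lambda>u::real^'n. (w \<bullet> u) ^ 4)" for w
      by (intro integrable_uniform_sphere_cont continuous_intros)
    have "2 * m = (\<integral>u. (p \<bullet> u) ^ 4 + (q \<bullet> u) ^ 4 \<partial>uniform_sphere)"
      using i1 n by (simp add: m)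
    also have "\<dots> = (\<integral>u. (?x u ^ 4 + ?y u ^ 4) / 2 + 3 * ((?x u)\<^sup>2 * (?y u)\<^sup>2) \<partial>uniform_sphere)"
      by (simp only: id)
    also have "\<dots> = (m + m) / 2 + 3 * (\<integral>u. (?x u)\<^sup>2 * (?y u)\<^sup>2 \<partial>uniform_sphere)"
      using i1 I by (simp add: m)
    finally show ?thesis by simp
  qed
  have "1 = (\<integral>u. (1::real) \<partial>(uniform_sphere :: (real ^ 'n) measure))" by (simp add: prob_space)
  also have "\<dots> = (\<integral>u. (\<Sum>i\<in>UNIV. \<Sum>j\<in>UNIV. (axis i 1 \<bullet> u)\<^sup>2 * (axis j 1 \<bullet> u)\<^sup>2) \<partial>(uniform_sphere :: (real ^ 'n) measure))"
  proof (rule integral_cong_AE)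
    show "AE u in (uniform_sphere :: (real ^ 'n) measure).
        1 = (\<Sum>i\<in>UNIV. \<Sum>j\<in>UNIV. (axis i 1 \<bullet> u)\<^sup>2 * (axis j 1 \<bullet> u)\<^sup>2)"
      using AE_uniform_sphere
    proof eventually_elim
      case (elim u)
      then have "u \<bullet> u = 1" by (simp add: dot_square_norm)
      then have "(\<Sum>i\<in>UNIV. u $ i * u $ i) = 1" by (simp add: inner_vec_def)
      then have "(\<Sum>i\<in>UNIV. (axis i 1 \<bullet> u)\<^sup>2) = 1" by (simp add: inner_axis' power2_eq_square)
      then show ?case by (simp add: sum_distrib_left[symmetric])
    qed
  qed measurable
  also have "\<dots> = (\<Sum>i\<in>UNIV. \<Sum>j\<in>UNIV. \<integral>u. (axis i 1 \<bullet> u)\<^sup>2 * (axis j 1 \<bullet> u)\<^sup>2 \<partial>(uniform_sphere :: (real ^ 'n) measure))"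
    using I by (simp add: Bochner_Integration.integral_sum)
  \<comment> \<open>The diagonal value m is split as m/3 + 2m/3, so that only the excess depends on
    whether i = j.\<close>
  also have "\<dots> = (\<Sum>i\<in>(UNIV::'n set). \<Sum>j\<in>(UNIV::'n set). m / 3 + (if i = j then 2 * m / 3 else 0))"
  proof (intro sum.cong refl)
    fix i j :: 'n
    show "(\<integral>u. (axis i 1 \<bullet> u)\<^sup>2 * (axis j 1 \<bullet> u)\<^sup>2 \<partial>(uniform_sphere :: (real ^ 'n) measure)) = m / 3 + (if i = j then 2 * m / 3 else 0)"
      using mixed[of i j] m[of "axis i 1"] by (auto simp: power2_eq_square power4_eq_xxxx mult.assoc)
  qed
  also have "\<dots> = CARD('n) * (CARD('n) * (m / 3)) + CARD('n) * (2 * m / 3)"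
    by (simp add: sum.distrib distrib_left)
  also have "\<dots> = real CARD('n) * (real CARD('n) + 2) * m / 3"
    by algebra
  finally have "m * (real CARD('n) * (real CARD('n) + 2)) = 3" by (simp add: algebra_simps)
  moreover have "real CARD('n) * (real CARD('n) + 2) \<noteq> 0"
    by (metis mult_pos_pos of_nat_0_less_iff zero_less_card_finite add_pos_pos zero_less_numeral less_irrefl)
  ultimately show ?thesis unfolding m_def[symmetric] by (metis nonzero_eq_divide_eq)
qed

lemma uniform_sphere_moment_bound:
  fixes v :: "real ^ 'n"
  assumes "norm v = 1"
  shows "(\<integral>u. (v \<bullet> u)\<^sup>2 - (v \<bullet> u) ^ 4 \<partial>uniform_sphere) \<le> 2 / 15"
proof -
  have "(\<integral>u. (v \<bullet> u)\<^sup>2 - (v \<bullet> u) ^ 4 \<partial>uniform_sphere) = 1 / CARD('n) - 3 / (real CARD('n) * (real CARD('n) + 2))"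
    using uniform_sphere_second_moment[OF assms] uniform_sphere_fourth_moment[OF assms]
    by (subst Bochner_Integration.integral_diff)
       (auto intro!: integrable_uniform_sphere_cont continuous_intros)
  also have "\<dots> \<le> 2 / 15"
  proof -
    define d where "d = CARD('n)"
    have d: "d \<ge> 1" by (simp add: d_def Suc_leI)
    \<comment> \<open>The bound is equivalent to this product being nonnegative. Its zeros are 5/2
      and 3, with no integer strictly between them.\<close>
    have "0 \<le> (2 * real d - 5) * (real d - 3)"
      using d by (cases "d \<le> 2") (auto intro!: mult_nonneg_nonneg mult_nonpos_nonpos)
    then have "real d - 1 \<le> 2 / 15 * (real d * (real d + 2))" by (simp add: algebra_simps)
    moreover have eq: "1 / real d - 3 / (real d * (real d + 2)) = (real d - 1) / (real d * (real d + 2))"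
    proof -
      have e: "1 / real d = (real d + 2) / (real d * (real d + 2))" using d by simp
      have "1 / real d - 3 / (real d * (real d + 2)) = (real d + 2 - 3) / (real d * (real d + 2))"
        by (simp only: e diff_divide_distrib)
      then show ?thesis by simp
    qed
    moreover have "0 < real d * (real d + 2)" using d by (intro mult_pos_pos) auto
    ultimately show ?thesis unfolding d_def[symmetric] eq by (simp only: pos_divide_le_eq)
  qed
  finally show ?thesis .
qed

section \<open>Spread of the eigenvalues\<close>

text \<open>For symmetric M this is the difference of the extremal eigenvalues. Written as a
  supremum of functions continuous in M it is visibly Borel measurable.\<close>

definition spread :: "real ^ 'n ^ 'n \<Rightarrow> real" where
  "spread M = (SUP p\<in>sphere 0 1 \<times> sphere 0 1. qform M (fst p) - qform M (snd p))"

lemma bdd_above_spread: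
  "bdd_above ((\<lambda>p. qform M (fst p) - qform M (snd p)) ` (sphere 0 1 \<times> sphere 0 1))"
proof -
  have "continuous_on UNIV (\<lambda>p. qform M (fst p) - qform M (snd p))"
    by (intro continuous_intros continuous_on_compose2[OF continuous_on_qform[of UNIV]]) auto
  then have "compact ((\<lambda>p. qform M (fst p) - qform M (snd p)) ` (sphere 0 1 \<times> sphere 0 1))"
    by (intro compact_continuous_image compact_Times compact_sphere) (rule continuous_on_subset, auto)
  then show ?thesis by (intro bounded_imp_bdd_above compact_imp_bounded)
qed

lemma spread_ge:
  assumes "norm v = 1" "norm w = 1"
  shows "qform M v - qform M w \<le> spread M"
  unfolding spread_def using cSUP_upper[OF _ bdd_above_spread, of "(v, w)" M] assms by simp

lemma spread_le:
  fixes M :: "real ^ 'n ^ 'n"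
  assumes "\<And>v w. norm v = 1 \<Longrightarrow> norm w = 1 \<Longrightarrow> qform M v - qform M w \<le> B"
  shows "spread M \<le> B"
  unfolding spread_def
proof (rule cSUP_least)
  show "sphere (0::real^'n) 1 \<times> sphere (0::real^'n) 1 \<noteq> {}" by simp
qed (use assms in auto)

lemma spread_nonneg: "0 \<le> spread M"
  using spread_ge[of "axis undefined 1" "axis undefined 1" M] by simp

lemma spread_extremal:
  assumes "norm v = 1" "norm w = 1"
    and "\<And>x. qform M x \<le> qform M v * (norm x)\<^sup>2" "\<And>x. qform M w * (norm x)\<^sup>2 \<le> qform M x"
  shows "spread M = qform M v - qform M w"
proof (rule antisym)
  show "spread M \<le> qform M v - qform M w"
  proof (rule spread_le)
    fix x y :: "real ^ 'a" assume "norm x = 1" "norm y = 1"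
    then show "qform M x - qform M y \<le> qform M v - qform M w"
      using assms(3)[of x] assms(4)[of y] by simp
  qed
qed (rule spread_ge[OF assms(1,2)])

lemma spread_le_form_between:
  assumes "form_between l L M"
  shows "spread M \<le> L - l"
proof (rule spread_le)
  fix x y :: "real ^ 'a" assume "norm x = 1" "norm y = 1"
  then show "qform M x - qform M y \<le> L - l"
    using assms[unfolded form_between_def, THEN conjunct2, rule_format, of x]
      assms[unfolded form_between_def, THEN conjunct2, rule_format, of y] by simp
qed

section \<open>Measurability of the spread and of the step\<close>

text \<open>A supremum of continuous functions is lower semicontinuous, even over an uncountable
  index set: its superlevel sets are unions of open sets.\<close>

lemma borel_measurable_SUP_continuous:
  fixes F :: "'a::topological_space \<Rightarrow> 'b \<Rightarrow> real"
  assumes cont: "\<And>x. x \<in> A \<Longrightarrow> continuous_on UNIV (\<lambda>M. F M x)" and ne: "A \<noteq> {}"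
    and bdd: "\<And>M. bdd_above (F M ` A)"
  shows "(\<lambda>M. SUP x\<in>A. F M x) \<in> borel_measurable borel"
proof (rule borel_measurableI_greater)
  fix y
  have "{M \<in> space borel. y < (SUP x\<in>A. F M x)} = (\<Union>x\<in>A. {M. y < F M x})"
    using less_cSUP_iff[OF ne bdd] by auto
  moreover have "open (\<Union>x\<in>A. {M. y < F M x})"
    using cont by (intro open_UN ballI open_Collect_less) auto
  ultimately show "{M \<in> space borel. y < (SUP x\<in>A. F M x)} \<in> sets borel" by simp
qed

lemma continuous_on_qform_matrix: "continuous_on S (\<lambda>M. qform M x)"
  unfolding qform_def inner_vec_def matrix_vector_mult_def by (simp, intro continuous_intros)

lemma borel_measurable_spread [measurable]: "spread \<in> borel_measurable borel"
proof -
  have "(\<lambda>M. SUP p\<in>sphere (0::real^'a) 1 \<times> sphere (0::real^'a) 1. qform M (fst p) - qform M (snd p)) \<in> borel_measurable borel"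
    by (intro borel_measurable_SUP_continuous bdd_above_spread continuous_intros continuous_on_qform_matrix) auto
  then show ?thesis by (simp add: spread_def[abs_def])
qed

lemma outer_measurable:
  "(\<lambda>p. outer (fst p) (snd p)) \<in> borel_measurable borel"
  by (rule borel_measurable_continuous_onI) (unfold outer_def, intro continuous_intros)

lemma matrix_vector_mult_measurable:
  "(\<lambda>p. fst p *v snd p :: real ^ 'm) \<in> borel_measurable (borel :: ((real ^ 'n ^ 'm) \<times> (real ^ 'n)) measure)"
  by (rule borel_measurable_continuous_onI) (unfold matrix_vector_mult_def, intro continuous_intros)

lemma sstep_measurable [measurable (raw)]:
  fixes f :: "'a \<Rightarrow> real ^ 'n ^ 'n" and g :: "'a \<Rightarrow> real ^ 'n"
  assumes [measurable]: "f \<in> borel_measurable N" "g \<in> borel_measurable N"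
  shows "(\<lambda>x. sstep (f x) (g x)) \<in> borel_measurable N"
proof -
  have mv [measurable]: "(\<lambda>x. f x *v g x) \<in> borel_measurable N"
    using measurable_compose[OF borel_measurable_Pair[OF assms] matrix_vector_mult_measurable] by simp
  have o [measurable]: "(\<lambda>x. outer (h x) (h x)) \<in> borel_measurable N"
    if "h \<in> borel_measurable N" for h :: "'a \<Rightarrow> real ^ 'n"
    using measurable_compose[OF borel_measurable_Pair[OF that that] outer_measurable] by simp
  have [measurable]: "(\<lambda>x. qform (f x) (g x)) \<in> borel_measurable N"
    unfolding qform_def by measurable
  show ?thesis unfolding sstep_def by measurable
qed

section \<open>Mean decay of the spread\<close>

text \<open>The vectors v and w are a top and a bottom eigenvector of M. They are chosen before u,
  so that the bound can be integrated over u.\<close>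

lemma spread_sstep:
  fixes M :: "real ^ 'n ^ 'n"
  assumes M: "form_between l L M" and l: "0 < l" and L: "L \<le> 2 * l"
  obtains v w where "norm v = 1" "norm w = 1"
    "\<And>u. norm u = 1 \<Longrightarrow>
      spread M * (1 - 3 * ((v \<bullet> u)\<^sup>2 - (v \<bullet> u) ^ 4) - 2 * ((w \<bullet> u)\<^sup>2 - (w \<bullet> u) ^ 4)) \<le> spread (sstep M u)"
proof -
  have sym: "transpose M = M" using M by (simp add: form_between_def)
  obtain v c where v: "norm v = 1" "M *v v = c *\<^sub>R v" "qform M v = c" "\<And>x. qform M x \<le> c * (norm x)\<^sup>2"
    using maximal_eigenvector[OF sym] by metis
  obtain w k where w: "norm w = 1" "M *v w = k *\<^sub>R w" "qform M w = k" "\<And>x. k * (norm x)\<^sup>2 \<le> qform M x"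
    using minimal_eigenvector[OF sym] by metis
  have sp: "spread M = c - k" using spread_extremal[of v w M] v w by simp
  show thesis
  proof (rule that[OF v(1) w(1)])
    fix u :: "real ^ 'n" assume u: "norm u = 1"
    define a where "a = qform M u"
    define s where "s = v \<bullet> u"
    define r where "r = w \<bullet> u"
    have B: "l * (norm x)\<^sup>2 \<le> qform M x" "qform M x \<le> L * (norm x)\<^sup>2" for x
      using M by (auto simp: form_between_def)
    have a: "0 < a" "k \<le> a" "a \<le> c" "c \<le> 2 * a" "0 < k"
      using B[of u] B[of v] B[of w] u v(1,3) v(4)[of u] w(1,3) w(4)[of u] l L by (auto simp: a_def)
    \<comment> \<open>The overlap of u with the eigenvectors limits how far a lies from c and from
      k: c - a \<le> (c - k)(1 - s^2) and a - k \<le> (c - k)(1 - r^2).\<close>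
    have a1: "k + (c - k) * s\<^sup>2 \<le> a" "a \<le> c - (c - k) * r\<^sup>2"
      using qform_ge_eigen[OF sym v(1,2) u w(4)] qform_le_eigen[OF sym w(1,2) u v(4)]
      by (simp_all add: a_def s_def r_def)
    \<comment> \<open>Equivalent to (c - a)(2a - c) \<ge> 0. The ratio condition enters here,
      through c \<le> L \<le> 2l \<le> 2a.\<close>
    have "c\<^sup>2 \<le> a * (a + 3 * (c - a))"
    proof -
      have "0 \<le> (c - a) * (2 * a - c)" using a by (intro mult_nonneg_nonneg) auto
      then show ?thesis by (simp add: power2_eq_square algebra_simps)
    qed
    then have "c\<^sup>2 / a \<le> a + 3 * (c - a)" using a(1) by (simp add: divide_le_eq mult.commute)
    then have "3 * (a - c) \<le> a - c\<^sup>2 / a" by simp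
    then have "s\<^sup>2 * (3 * (a - c)) \<le> s\<^sup>2 * (a - c\<^sup>2 / a)" by (intro mult_left_mono) auto
    moreover have "s\<^sup>2 * (3 * ((c - k) * (s\<^sup>2 - 1))) \<le> s\<^sup>2 * (3 * (a - c))"
      using a1(1) by (intro mult_left_mono) (auto simp: algebra_simps)
    ultimately have 1: "c - (c - k) * (3 * (s\<^sup>2 - s ^ 4)) \<le> qform (sstep M u) v"
      unfolding qform_sstep_eigen[OF sym v(1,2)] a_def[symmetric] s_def[symmetric]
      by (simp add: algebra_simps power2_eq_square power4_eq_xxxx)
    \<comment> \<open>The tangent at a to the parabola k^2 lies below it.\<close>
    have "a * (a - 2 * (a - k)) \<le> k\<^sup>2"
    proof -
      have "0 \<le> (a - k)\<^sup>2" by simp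
      then show ?thesis by (simp add: power2_eq_square algebra_simps)
    qed
    then have "a - 2 * (a - k) \<le> k\<^sup>2 / a" using a(1) by (simp add: le_divide_eq mult.commute)
    then have "r\<^sup>2 * (a - k\<^sup>2 / a) \<le> r\<^sup>2 * (2 * (a - k))" by (intro mult_left_mono) auto
    moreover have "r\<^sup>2 * (2 * (a - k)) \<le> r\<^sup>2 * (2 * ((c - k) * (1 - r\<^sup>2)))"
      using a1(2) by (intro mult_left_mono) (auto simp: algebra_simps)
    ultimately have 2: "qform (sstep M u) w \<le> k + (c - k) * (2 * (r\<^sup>2 - r ^ 4))"
      unfolding qform_sstep_eigen[OF sym w(1,2)] a_def[symmetric] r_def[symmetric]
      by (simp add: algebra_simps power2_eq_square power4_eq_xxxx)
    have "spread M * (1 - 3 * (s\<^sup>2 - s ^ 4) - 2 * (r\<^sup>2 - r ^ 4))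
        = (c - (c - k) * (3 * (s\<^sup>2 - s ^ 4))) - (k + (c - k) * (2 * (r\<^sup>2 - r ^ 4)))"
      by (simp add: sp algebra_simps)
    also have "\<dots> \<le> qform (sstep M u) v - qform (sstep M u) w" using 1 2 by (rule diff_mono)
    also have "\<dots> \<le> spread (sstep M u)" by (rule spread_ge[OF v(1) w(1)])
    finally show "spread M * (1 - 3 * ((v \<bullet> u)\<^sup>2 - (v \<bullet> u) ^ 4) - 2 * ((w \<bullet> u)\<^sup>2 - (w \<bullet> u) ^ 4)) \<le> spread (sstep M u)"
      by (simp only: s_def r_def)
  qed
qed

text \<open>The bound \<open>2/15\<close> on the moments (attained in dimension 3) gives \<open>1 - 5 * 2/15 = 1/3\<close>.\<close>

lemma expected_spread_sstep:
  fixes M :: "real ^ 'n ^ 'n"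
  assumes M: "form_between l L M" and l: "0 < l" and L: "L \<le> 2 * l"
  shows "ennreal (spread M / 3) \<le> (\<integral>\<^sup>+ u. ennreal (spread (sstep M u)) \<partial>uniform_sphere)"
proof -
  interpret prob_space "uniform_sphere :: (real ^ 'n) measure" by (rule prob_space_uniform_sphere)
  obtain v w where v: "norm v = 1" and w: "norm w = 1" and le:
    "\<And>u. norm u = 1 \<Longrightarrow>
      spread M * (1 - 3 * ((v \<bullet> u)\<^sup>2 - (v \<bullet> u) ^ 4) - 2 * ((w \<bullet> u)\<^sup>2 - (w \<bullet> u) ^ 4)) \<le> spread (sstep M u)"
    using spread_sstep[OF M l L] by blast
  have int: "integrable uniform_sphere (\<lambda>u. spread (sstep M u))"
  proof (rule integrable_uniform_sphere)
    fix u :: "real ^ 'n" assume "norm u = 1"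
    then show "\<bar>spread (sstep M u)\<bar> \<le> L - l"
      using spread_le_form_between[OF form_between_sstep[OF M l]] spread_nonneg[of "sstep M u"] by simp
  qed measurable
  have I: "integrable uniform_sphere (\<lambda>u::real^'n. (x \<bullet> u)\<^sup>2 - (x \<bullet> u) ^ 4)" for x
    by (intro integrable_uniform_sphere_cont continuous_intros)
  have "spread M / 3 = spread M * (1 - 3 * (2 / 15) - 2 * (2 / 15))" by simp
  also have "\<dots> \<le> spread M * (1 - 3 * (\<integral>u. (v \<bullet> u)\<^sup>2 - (v \<bullet> u) ^ 4 \<partial>uniform_sphere)
      - 2 * (\<integral>u. (w \<bullet> u)\<^sup>2 - (w \<bullet> u) ^ 4 \<partial>uniform_sphere))"
    using uniform_sphere_moment_bound[OF v] uniform_sphere_moment_bound[OF w]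
    by (intro mult_left_mono spread_nonneg diff_mono) auto
  also have "\<dots> = (\<integral>u. spread M * (1 - 3 * ((v \<bullet> u)\<^sup>2 - (v \<bullet> u) ^ 4) - 2 * ((w \<bullet> u)\<^sup>2 - (w \<bullet> u) ^ 4)) \<partial>uniform_sphere)"
  proof -
    define F G :: "real ^ 'n \<Rightarrow> real" where "F u = (v \<bullet> u)\<^sup>2 - (v \<bullet> u) ^ 4"
      and "G u = (w \<bullet> u)\<^sup>2 - (w \<bullet> u) ^ 4" for u
    have "integrable uniform_sphere F" "integrable uniform_sphere G"
      using I by (simp_all add: F_def[abs_def] G_def[abs_def])
    then show ?thesis unfolding F_def[symmetric] G_def[symmetric] by (simp add: prob_space)
  qed
  also have "\<dots> \<le> (\<integral>u. spread (sstep M u) \<partial>uniform_sphere)"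
  proof (rule integral_mono_AE[OF _ int])
    show "integrable uniform_sphere
      (\<lambda>u. spread M * (1 - 3 * ((v \<bullet> u)\<^sup>2 - (v \<bullet> u) ^ 4) - 2 * ((w \<bullet> u)\<^sup>2 - (w \<bullet> u) ^ 4)))"
      by (intro integrable_uniform_sphere_cont continuous_intros)
    show "AE u in uniform_sphere.
      spread M * (1 - 3 * ((v \<bullet> u)\<^sup>2 - (v \<bullet> u) ^ 4) - 2 * ((w \<bullet> u)\<^sup>2 - (w \<bullet> u) ^ 4)) \<le> spread (sstep M u)"
      using AE_uniform_sphere by eventually_elim (use le in auto)
  qed
  finally have "ennreal (spread M / 3) \<le> ennreal (\<integral>u. spread (sstep M u) \<partial>uniform_sphere)"
    by (rule ennreal_leI)
  also have "\<dots> = (\<integral>\<^sup>+ u. ennreal (spread (sstep M u)) \<partial>uniform_sphere)"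
    by (rule nn_integral_eq_integral[OF int, symmetric]) (simp add: spread_nonneg)
  finally show ?thesis .
qed

text \<open>The product space over 1..n is fixed while m runs up to n, so that the induction on m
  stays in one space.\<close>

lemma sstep_seq_measurable:
  assumes "m \<le> n"
  shows "(\<lambda>x. sstep_seq x m M) \<in> borel_measurable (\<Pi>\<^sub>M i\<in>{1..n}. borel)"
  using assms
proof (induction m)
  case (Suc m)
  then have [measurable]: "(\<lambda>x. sstep_seq x m M) \<in> borel_measurable (\<Pi>\<^sub>M i\<in>{1..n}. borel)"
    "(\<lambda>x. x (Suc m)) \<in> borel_measurable (\<Pi>\<^sub>M i\<in>{1..n}. (borel :: (real ^ 'a) measure))"
    by auto
  show ?case unfolding sstep_seq.simps by (rule sstep_measurable) fact+
qed simp

lemma sstep_seq_cong: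
  assumes "\<And>i. 1 \<le> i \<Longrightarrow> i \<le> n \<Longrightarrow> u i = v i"
  shows "sstep_seq u n M = sstep_seq v n M"
  using assms by (induction n) auto

text \<open>The matrix after n steps depends on the first n directions only, hence is independent of
  the next one. Integrating over that direction first reduces the claim to the one-step bound;
  nonnegative integrals permit this without integrability.\<close>

lemma expected_spread_sstep_seq:
  fixes M :: "real ^ 'n ^ 'n" and U :: "nat \<Rightarrow> 'w \<Rightarrow> real ^ 'n"
  assumes P: "prob_space P" and U: "iid_uniform_sphere P U"
    and M: "form_between l L M" and l: "0 < l" and L: "L \<le> 2 * l"
  defines "X \<equiv> \<lambda>n \<omega>. sstep_seq (\<lambda>i. U i \<omega>) n M"
  shows "X n \<in> borel_measurable P"
    and "ennreal (spread M * (1 / 3) ^ n) \<le> (\<integral>\<^sup>+ \<omega>. ennreal (spread (X n \<omega>)) \<partial>P)"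
proof -
  interpret prob_space P by (rule P)
  have ind: "indep_vars (\<lambda>_. borel) U {1..}" and sph: "\<And>i \<omega>. i \<ge> 1 \<Longrightarrow> \<omega> \<in> space P \<Longrightarrow> norm (U i \<omega>) = 1"
    and dst: "\<And>i. i \<ge> 1 \<Longrightarrow> distr P borel (U i) = uniform_sphere"
    using U by (auto simp: iid_uniform_sphere_def)
  let ?S = "\<lambda>I. (\<Pi>\<^sub>M i\<in>I. borel) :: (nat \<Rightarrow> real ^ 'n) measure"
  define R where "R I \<omega> = restrict (\<lambda>i. U i \<omega>) I" for I \<omega>
  have iv: "indep_var (?S {1..n}) (R {1..n}) (?S {Suc n}) (R {Suc n})" for n
    unfolding R_def by (rule indep_var_restrict[OF ind]) auto
  have Rm [measurable]: "R {1..n} \<in> measurable P (?S {1..n})" "R {Suc n} \<in> measurable P (?S {Suc n})" for n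
    using iv[of n] by (auto dest: indep_var_rv1 indep_var_rv2)
  have X_eq: "X n \<omega> = sstep_seq (R {1..n} \<omega>) n M" for n \<omega>
    unfolding X_def R_def by (intro sstep_seq_cong) auto
  have Xm [measurable]: "X n \<in> borel_measurable P" for n
    using measurable_compose[OF Rm(1) sstep_seq_measurable[OF order_refl]] by (simp add: X_eq[abs_def])
  have Um [measurable]: "U (Suc n) \<in> borel_measurable P" for n
    using ind unfolding indep_vars_def by simp
  show "X n \<in> borel_measurable P" by (rule Xm)
  show "ennreal (spread M * (1 / 3) ^ n) \<le> (\<integral>\<^sup>+ \<omega>. ennreal (spread (X n \<omega>)) \<partial>P)"
  proof (induction n)
    case 0
    then show ?case by (simp add: X_def emeasure_space_1)
  next
    case (Suc n)
    interpret S: prob_space "distr P (?S {Suc n}) (R {Suc n})" by (rule prob_space_distr) (rule Rm)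
    \<comment> \<open>By independence the joint law of the first n directions and the next one is a
      product, as Tonelli's theorem requires.\<close>
    have joint: "distr P (?S {1..n} \<Otimes>\<^sub>M ?S {Suc n}) (\<lambda>\<omega>. (R {1..n} \<omega>, R {Suc n} \<omega>))
        = distr P (?S {1..n}) (R {1..n}) \<Otimes>\<^sub>M distr P (?S {Suc n}) (R {Suc n})"
      using iv[of n] by (simp add: indep_var_distribution_eq)
    define F where "F x y = ennreal (spread (sstep (sstep_seq x n M) (y (Suc n))))" for x y :: "nat \<Rightarrow> real ^ 'n"
    have sm [measurable]: "(\<lambda>x. sstep_seq x n M) \<in> borel_measurable (?S {1..n})"
      by (rule sstep_seq_measurable) simp
    have Fm [measurable]: "(\<lambda>p. F (fst p) (snd p)) \<in> borel_measurable (?S {1..n} \<Otimes>\<^sub>M ?S {Suc n})"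
      unfolding F_def by measurable
    have "(\<integral>\<^sup>+ \<omega>. ennreal (spread (X (Suc n) \<omega>)) \<partial>P) = (\<integral>\<^sup>+ \<omega>. F (R {1..n} \<omega>) (R {Suc n} \<omega>) \<partial>P)"
      unfolding F_def X_eq[symmetric] by (simp add: X_def R_def)
    also have "\<dots> = (\<integral>\<^sup>+ p. F (fst p) (snd p)
        \<partial>distr P (?S {1..n} \<Otimes>\<^sub>M ?S {Suc n}) (\<lambda>\<omega>. (R {1..n} \<omega>, R {Suc n} \<omega>)))"
      by (subst nn_integral_distr[OF measurable_Pair[OF Rm]])
         (simp_all only: measurable_distr_eq1 Fm fst_conv snd_conv)
    also have "\<dots> = (\<integral>\<^sup>+ x. (\<integral>\<^sup>+ y. F x y \<partial>distr P (?S {Suc n}) (R {Suc n})) \<partial>distr P (?S {1..n}) (R {1..n}))"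
    proof -
      have "(\<lambda>p. F (fst p) (snd p)) \<in> borel_measurable
          (distr P (?S {1..n}) (R {1..n}) \<Otimes>\<^sub>M distr P (?S {Suc n}) (R {Suc n}))"
        using Fm by (subst measurable_cong_sets[OF sets_pair_measure_cong[OF sets_distr sets_distr] refl])
      from S.nn_integral_fst[OF this] show ?thesis unfolding joint by simp
    qed
    also have "\<dots> = (\<integral>\<^sup>+ \<omega>. (\<integral>\<^sup>+ y. F (R {1..n} \<omega>) y \<partial>distr P (?S {Suc n}) (R {Suc n})) \<partial>P)"
      by (rule nn_integral_distr) measurable
    also have "\<dots> = (\<integral>\<^sup>+ \<omega>. (\<integral>\<^sup>+ u. ennreal (spread (sstep (X n \<omega>) u)) \<partial>uniform_sphere) \<partial>P)"
    proof (rule nn_integral_cong)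
      fix \<omega>
      have "(\<integral>\<^sup>+ y. F (R {1..n} \<omega>) y \<partial>distr P (?S {Suc n}) (R {Suc n}))
          = (\<integral>\<^sup>+ \<omega>'. F (R {1..n} \<omega>) (R {Suc n} \<omega>') \<partial>P)"
        unfolding F_def by (rule nn_integral_distr) measurable
      also have "\<dots> = (\<integral>\<^sup>+ \<omega>'. ennreal (spread (sstep (X n \<omega>) (U (Suc n) \<omega>'))) \<partial>P)"
        by (simp add: F_def X_eq R_def)
      also have "\<dots> = (\<integral>\<^sup>+ u. ennreal (spread (sstep (X n \<omega>) u)) \<partial>distr P borel (U (Suc n)))"
        by (rule nn_integral_distr[symmetric]) measurable
      finally show "(\<integral>\<^sup>+ y. F (R {1..n} \<omega>) y \<partial>distr P (?S {Suc n}) (R {Suc n}))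
          = (\<integral>\<^sup>+ u. ennreal (spread (sstep (X n \<omega>) u)) \<partial>uniform_sphere)"
        by (simp add: dst)
    qed
    \<comment> \<open>For each fixed \<omega> the matrix \<open>X n \<omega>\<close> keeps the
      bounds l and L, so the one-step bound applies under the outer integral.\<close>
    also have "\<dots> \<ge> (\<integral>\<^sup>+ \<omega>. ennreal (1 / 3) * ennreal (spread (X n \<omega>)) \<partial>P)"
    proof (rule nn_integral_mono)
      fix \<omega> assume "\<omega> \<in> space P"
      then have "form_between l L (X n \<omega>)"
        unfolding X_def using M l sph by (intro form_between_sstep_seq) auto
      then show "ennreal (1 / 3) * ennreal (spread (X n \<omega>))
          \<le> (\<integral>\<^sup>+ u. ennreal (spread (sstep (X n \<omega>) u)) \<partial>uniform_sphere)"
        using expected_spread_sstep[OF _ l L, of "X n \<omega>"] by (simp add: ennreal_mult'[symmetric] spread_nonneg)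
    qed
    finally have "(\<integral>\<^sup>+ \<omega>. ennreal (1 / 3) * ennreal (spread (X n \<omega>)) \<partial>P)
        \<le> (\<integral>\<^sup>+ \<omega>. ennreal (spread (X (Suc n) \<omega>)) \<partial>P)" .
    moreover have "ennreal (spread M * (1 / 3) ^ Suc n)
        \<le> (\<integral>\<^sup>+ \<omega>. ennreal (1 / 3) * ennreal (spread (X n \<omega>)) \<partial>P)"
    proof -
      have "ennreal (spread M * (1 / 3) ^ Suc n) = ennreal (1 / 3) * ennreal (spread M * (1 / 3) ^ n)"
        by (subst ennreal_mult'[symmetric]) (simp_all add: mult_ac)
      also have "\<dots> \<le> ennreal (1 / 3) * (\<integral>\<^sup>+ \<omega>. ennreal (spread (X n \<omega>)) \<partial>P)"
        using Suc by (rule mult_left_mono) simp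
      also have "\<dots> = (\<integral>\<^sup>+ \<omega>. ennreal (1 / 3) * ennreal (spread (X n \<omega>)) \<partial>P)"
        by (rule nn_integral_cmult[symmetric]) measurable
      finally show ?thesis .
    qed
    ultimately show ?case by (rule order_trans[rotated])
  qed
qed

section \<open>Comparing the distance to the rearrangement with the spread\<close>

lemma bump_bounds:
  assumes "form_between l L M" "0 < l"
  shows "0 \<le> bump M x" "bump M x \<le> 1"
  using form_between_nonneg[OF assms, of x] by (auto simp: bump_def)

lemma rearrangement_bump_bounds:
  assumes M: "form_between l L M" and l: "0 < l"
  shows "0 \<le> rearrangement (bump M) x" "rearrangement (bump M) x \<le> 1"
proof -
  have "max (1 - l * (norm x)\<^sup>2) 0 \<le> 1" using l by simp
  then show "0 \<le> rearrangement (bump M) x" "rearrangement (bump M) x \<le> 1"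
    using rearrangement_bump(1,2)[OF M l, of x] by linarith+
qed

lemma sup_norm_ge:
  assumes "\<And>x. \<bar>g x\<bar> \<le> B"
  shows "\<bar>g x\<bar> \<le> sup_norm g"
  unfolding sup_norm_def using assms by (intro cSUP_upper bdd_aboveI2) auto

lemma sup_norm_le:
  assumes "\<And>x. \<bar>g x\<bar> \<le> B"
  shows "sup_norm g \<le> B"
  unfolding sup_norm_def using assms by (intro cSUP_least) auto

lemma bump_rearrangement_diff_bound:
  assumes "form_between l L M" "0 < l" "form_between l L N"
  shows "\<bar>bump N x - rearrangement (bump M) x\<bar> \<le> 1"
  using bump_bounds[OF assms(3,2), of x] rearrangement_bump_bounds[OF assms(1,2), of x] by linarith

text \<open>The rearrangement is radial, so at two points of equal norm the values of
  \<open>bump N\<close> differ by at most twice the distance.\<close>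

lemma spread_le_sup_norm:
  fixes M N :: "real ^ 'n ^ 'n"
  assumes M: "form_between l L M" and l: "0 < l" and N: "form_between l L N" and L: "0 < L"
  shows "spread N / (2 * L) \<le> sup_norm (\<lambda>x. bump N x - rearrangement (bump M) x)"
proof -
  let ?R = "rearrangement (bump M)"
  let ?s = "sup_norm (\<lambda>x. bump N x - ?R x)"
  have "spread N \<le> 2 * L * ?s"
  proof (rule spread_le)
    fix v w :: "real ^ 'n" assume v: "norm v = 1" "norm w = 1"
    \<comment> \<open>At radius 1 / sqrt L the truncation is inactive, because the form of N is at
      most L on unit vectors.\<close>
    define t where "t = 1 / sqrt L"
    have t: "t\<^sup>2 = 1 / L" using L by (simp add: t_def power_divide)
    have b: "bump N (t *\<^sub>R x) = 1 - qform N x / L" if "norm x = 1" for x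
    proof -
      have "qform N x \<le> L" using N that unfolding form_between_def by (metis mult.right_neutral one_power2)
      then show ?thesis using L by (simp add: bump_def qform_scale t field_simps)
    qed
    have up: "\<bar>bump N x - ?R x\<bar> \<le> ?s" for x
      by (rule sup_norm_ge[where g = "\<lambda>x. bump N x - ?R x"]) (rule bump_rearrangement_diff_bound[OF M l N])
    have "?R (t *\<^sub>R v) = ?R (t *\<^sub>R w)" using v by (intro rearrangement_bump(3)[OF M l]) simp
    then have "(qform N v - qform N w) / L \<le> 2 * ?s"
      using up[of "t *\<^sub>R v"] up[of "t *\<^sub>R w"] v by (simp add: b diff_divide_distrib)
    then show "qform N v - qform N w \<le> 2 * L * ?s" using L by (simp add: divide_le_eq mult_ac)
  qed
  then show ?thesis using L by (simp add: divide_le_eq mult_ac)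
qed

text \<open>Both functions lie between the caps with coefficients L and l. The gap between these
  caps is largest at |x|^2 = 1/L, where it equals 1 - l/L.\<close>

lemma sup_norm_le_spread:
  fixes M :: "real ^ 'n ^ 'n"
  assumes M: "form_between l L M" and l: "0 < l" and "l \<le> L"
  shows "sup_norm (\<lambda>x. bump M x - rearrangement (bump M) x) \<le> (L - l) / L"
proof (rule sup_norm_le)
  fix x :: "real ^ 'n"
  define q where "q = (norm x)\<^sup>2"
  have L: "0 < L" using assms by simp
  have Q: "l * q \<le> qform M x" "qform M x \<le> L * q" using M by (auto simp: form_between_def q_def)
  have q: "0 \<le> q" by (simp add: q_def)
  have "max (1 - l * q) 0 - max (1 - L * q) 0 \<le> (L - l) / L"
  proof (cases "L * q \<le> 1")
    case True
    then have "q \<le> 1 / L" using L by (simp add: pos_le_divide_eq mult.commute)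
    then have "(L - l) * q \<le> (L - l) * (1 / L)" using assms by (intro mult_left_mono) auto
    moreover have "l * q \<le> L * q" using assms q by (intro mult_right_mono) auto
    ultimately show ?thesis using True by (simp add: left_diff_distrib)
  next
    case False
    then have "1 / L \<le> q" using L by (simp add: pos_divide_le_eq mult.commute)
    then have "l * (1 / L) \<le> l * q" using l by (intro mult_left_mono) auto
    moreover have "(L - l) / L = 1 - l * (1 / L)" "0 \<le> (L - l) / L"
      using L assms by (simp_all add: diff_divide_distrib)
    ultimately show ?thesis using False by linarith
  qed
  moreover have "max (1 - L * q) 0 \<le> bump M x" "bump M x \<le> max (1 - l * q) 0"
    using Q by (auto simp: bump_def)
  ultimately show "\<bar>bump M x - rearrangement (bump M) x\<bar> \<le> (L - l) / L"
    using rearrangement_bump(1,2)[OF M l, of x, folded q_def] by linarith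
qed

text \<open>The truncation by \<open>1\<close> changes nothing for positive semidefinite \<open>M\<close>, but keeps the supremum
  meaningful for all other matrices.\<close>

lemma sup_norm_bump_measurable:
  fixes R :: "real ^ 'n \<Rightarrow> real"
  assumes R: "\<And>x. 0 \<le> R x" "\<And>x. R x \<le> 1"
  shows "(\<lambda>M. sup_norm (\<lambda>x. min 1 (bump M x) - R x)) \<in> borel_measurable borel"
  unfolding sup_norm_def
proof (rule borel_measurable_SUP_continuous)
  show "continuous_on UNIV (\<lambda>M. \<bar>min 1 (bump M x) - R x\<bar>)" for x
    unfolding bump_def
    by (intro continuous_on_rabs continuous_on_diff continuous_on_min continuous_on_max
        continuous_on_const continuous_on_qform_matrix)
  show "bdd_above (range (\<lambda>x. \<bar>min 1 (bump M x) - R x\<bar>))" for M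
  proof (rule bdd_aboveI2)
    fix x
    have "0 \<le> min 1 (bump M x)" "min 1 (bump M x) \<le> 1" unfolding bump_def by linarith+
    then show "\<bar>min 1 (bump M x) - R x\<bar> \<le> 1" using R[of x] by linarith
  qed
qed simp

text \<open>The mean distance is at least the mean spread over 2L, hence at least 3^(-n) / (2L)
  times the initial spread, while the initial distance is at most the initial spread over L.\<close>

lemma expected_distance_lower_bound:
  fixes M :: "real ^ 'n ^ 'n" and U :: "nat \<Rightarrow> 'w \<Rightarrow> real ^ 'n"
  assumes M: "symmetric_posdef M" and P: "prob_space P" and U: "iid_uniform_sphere P U"
    and ratio: "lambda_max M \<le> 2 * lambda_min M"
  shows "1 / 4 * sup_norm (\<lambda>x. bump M x - rearrangement (bump M) x) * (1 / 3) ^ n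
    \<le> (\<integral>\<omega>. sup_norm (\<lambda>x. steiner_seq (\<lambda>i. U i \<omega>) n (bump M) x - rearrangement (bump M) x) \<partial>P)"
proof -
  interpret prob_space P by (rule P)
  define l L where "l = lambda_min M" and "L = lambda_max M"
  let ?R = "rearrangement (bump M)"
  have fb: "form_between l L M" and l: "0 < l" and Ll: "L \<le> 2 * l"
    using form_between_lambda[OF M] ratio by (auto simp: l_def L_def)
  obtain v w where vw: "norm v = 1" "qform M v = L" "norm w = 1" "qform M w = l"
    using form_between_lambda[OF M] by (auto simp: l_def L_def)
  have "L - l \<le> spread M" using spread_ge[of v w M] vw by simp
  then have sp: "spread M = L - l" using spread_le_form_between[OF fb] by simp
  have lL: "l \<le> L" using sp spread_nonneg[of M] by simp
  have L: "0 < L" using l lL by simp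
  define X where "X \<omega> = sstep_seq (\<lambda>i. U i \<omega>) n M" for \<omega>
  have Xm [measurable]: "X \<in> borel_measurable P"
    and Xe: "ennreal (spread M * (1 / 3) ^ n) \<le> (\<integral>\<^sup>+ \<omega>. ennreal (spread (X \<omega>)) \<partial>P)"
    using expected_spread_sstep_seq[OF P U fb l Ll, of n] by (simp_all add: X_def[abs_def])
  define g where "g \<omega> = sup_norm (\<lambda>x. bump (X \<omega>) x - ?R x)" for \<omega>
  have sph: "\<And>i. i \<ge> 1 \<Longrightarrow> norm (U i \<omega>) = 1" if "\<omega> \<in> space P" for \<omega>
    using U that by (auto simp: iid_uniform_sphere_def)
  have fX: "form_between l L (X \<omega>)" if "\<omega> \<in> space P" for \<omega>
    unfolding X_def using fb l sph[OF that] by (rule form_between_sstep_seq)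
  have R: "0 \<le> ?R x" "?R x \<le> 1" for x using rearrangement_bump_bounds[OF fb l] by auto
  \<comment> \<open>Integrability of g matters, since the Bochner integral of a non-integrable
    function is 0. Measurability comes from a truncated version that agrees with g on the sample
    space.\<close>
  have "g \<in> borel_measurable P"
  proof -
    have "(\<lambda>\<omega>. sup_norm (\<lambda>x. min 1 (bump (X \<omega>) x) - ?R x)) \<in> borel_measurable P"
      using measurable_compose[OF Xm sup_norm_bump_measurable[of ?R]] R by simp
    moreover have "g \<omega> = sup_norm (\<lambda>x. min 1 (bump (X \<omega>) x) - ?R x)" if "\<omega> \<in> space P" for \<omega>
      unfolding g_def using bump_bounds(2)[OF fX[OF that] l] by (simp add: min_absorb2)
    ultimately show ?thesis by (subst measurable_cong)
  qed
  moreover have g: "0 \<le> g \<omega>" "g \<omega> \<le> 1" if "\<omega> \<in> space P" for \<omega>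
  proof -
    have b: "\<bar>bump (X \<omega>) x - ?R x\<bar> \<le> 1" for x by (rule bump_rearrangement_diff_bound[OF fb l fX[OF that]])
    show "g \<omega> \<le> 1" unfolding g_def using b by (rule sup_norm_le)
    have "\<bar>bump (X \<omega>) 0 - ?R 0\<bar> \<le> g \<omega>" unfolding g_def
      by (rule sup_norm_ge[where g = "\<lambda>x. bump (X \<omega>) x - ?R x"]) (rule b)
    then show "0 \<le> g \<omega>" by linarith
  qed
  ultimately have gi: "integrable P g"
    by (intro integrable_const_bound[of g 1]) (auto intro!: AE_I2)
  have "ennreal (1 / (2 * L)) * ennreal (spread M * (1 / 3) ^ n)
      \<le> ennreal (1 / (2 * L)) * (\<integral>\<^sup>+ \<omega>. ennreal (spread (X \<omega>)) \<partial>P)"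
    using Xe by (rule mult_left_mono) simp
  also have "\<dots> = (\<integral>\<^sup>+ \<omega>. ennreal (1 / (2 * L)) * ennreal (spread (X \<omega>)) \<partial>P)"
    by (rule nn_integral_cmult[symmetric]) measurable
  also have "\<dots> \<le> (\<integral>\<^sup>+ \<omega>. ennreal (g \<omega>) \<partial>P)"
  proof (rule nn_integral_mono)
    fix \<omega> assume "\<omega> \<in> space P"
    then have "spread (X \<omega>) / (2 * L) \<le> g \<omega>"
      unfolding g_def by (intro spread_le_sup_norm[OF fb l fX L])
    then show "ennreal (1 / (2 * L)) * ennreal (spread (X \<omega>)) \<le> ennreal (g \<omega>)"
      using L by (simp add: ennreal_mult'[symmetric] spread_nonneg ennreal_leI)
  qed
  also have "\<dots> = ennreal (\<integral>\<omega>. g \<omega> \<partial>P)"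
    by (rule nn_integral_eq_integral[OF gi]) (use g in \<open>auto intro!: AE_I2\<close>)
  finally have "ennreal (1 / (2 * L) * (spread M * (1 / 3) ^ n)) \<le> ennreal (\<integral>\<omega>. g \<omega> \<partial>P)"
    using L spread_nonneg[of M] by (simp add: ennreal_mult'[symmetric])
  moreover have "0 \<le> (\<integral>\<omega>. g \<omega> \<partial>P)" by (intro integral_nonneg_AE AE_I2) (rule g(1))
  ultimately have lower: "1 / (2 * L) * (spread M * (1 / 3) ^ n) \<le> (\<integral>\<omega>. g \<omega> \<partial>P)"
    by (simp add: ennreal_le_iff)
  let ?s = "sup_norm (\<lambda>x. bump M x - ?R x)"
  have s: "?s \<le> spread M / L" unfolding sp by (rule sup_norm_le_spread[OF fb l lL])
  \<comment> \<open>A factor 2 is given away here: the two comparisons of distance and spread yield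
    the constant 1/2.\<close>
  have s': "1 / 4 * ?s \<le> 1 / 2 * (spread M / L)"
  proof -
    have "0 \<le> spread M / L" using spread_nonneg[of M] L by simp
    then show ?thesis using s by linarith
  qed
  have "1 / 4 * ?s * (1 / 3) ^ n \<le> 1 / 2 * (spread M / L) * (1 / 3) ^ n"
    using s' by (rule mult_right_mono) simp
  also have "\<dots> = 1 / (2 * L) * (spread M * (1 / 3) ^ n)" by simp
  also have "\<dots> \<le> (\<integral>\<omega>. g \<omega> \<partial>P)" by (rule lower)
  also have "\<dots> = (\<integral>\<omega>. sup_norm (\<lambda>x. steiner_seq (\<lambda>i. U i \<omega>) n (bump M) x - ?R x) \<partial>P)"
  proof (rule Bochner_Integration.integral_cong[OF refl])
    fix \<omega> assume "\<omega> \<in> space P"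
    then show "g \<omega> = sup_norm (\<lambda>x. steiner_seq (\<lambda>i. U i \<omega>) n (bump M) x - ?R x)"
      using steiner_seq_bump[OF fb l, of "\<lambda>i. U i \<omega>" n] sph by (simp add: g_def X_def)
  qed
  finally show ?thesis .
qed

section \<open>A dense slow walk on the sphere\<close>

text \<open>If every diagonal entry equalled the maximum c, each axis vector would be an eigenvector
  for c and M would be scalar. So some diagonal entry lies below c.\<close>

lemma trace_less_of_nonscalar:
  fixes M :: "real ^ 'n ^ 'n" and c :: real
  assumes sym: "transpose M = M" and le: "\<And>x. qform M x \<le> c * (norm x)\<^sup>2"
    and ns: "\<nexists>k. M = k *\<^sub>R mat 1"
  shows "trace M < CARD('n) * c"
proof -
  have le1: "qform M (axis i 1) \<le> c" for i using le[of "axis i 1"] by simp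
  have "\<exists>i. qform M (axis i 1) < c"
  proof (rule ccontr)
    assume "\<nexists>i. qform M (axis i 1) < c"
    then have "qform M (axis i 1) = c" for i using le1[of i] by (meson order_le_imp_less_or_eq)
    then have eig: "M *v axis i 1 = c *\<^sub>R axis i 1" for i
      by (intro maximal_eigenvector_of[OF sym le]) simp
    have "M $ j $ i = (c *\<^sub>R mat 1 :: real ^ 'n ^ 'n) $ j $ i" for i j
    proof -
      have "M $ j $ i = (M *v axis i 1) $ j" by (simp add: matrix_vector_mult_basis column_def)
      then show ?thesis unfolding eig by (simp add: mat_def axis_def)
    qed
    then have "M = c *\<^sub>R mat 1" by (simp add: vec_eq_iff)
    then show False using ns by blast
  qed
  then obtain i where i: "qform M (axis i 1) < c" by blast
  have "(\<Sum>j\<in>UNIV. qform M (axis j 1)) < (\<Sum>j\<in>(UNIV::'n set). c)"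
    by (rule sum_strict_mono_ex1) (use le1 i in auto)
  then show ?thesis by (simp add: trace_eq_qform)
qed

text \<open>Excludes dimension 1, where the sphere consists of two points and carries no slow
  walk.\<close>

lemma card_ge_2_of_nonscalar:
  fixes M :: "real ^ 'n ^ 'n"
  assumes "\<nexists>k. M = k *\<^sub>R mat 1"
  shows "2 \<le> CARD('n)"
proof (rule ccontr)
  assume "\<not> 2 \<le> CARD('n)"
  moreover have "0 < CARD('n)" by simp
  ultimately have "CARD('n) = 1" by linarith
  then obtain i where U: "(UNIV :: 'n set) = {i}" by (rule card_1_singletonE)
  have i: "j = i" for j :: 'n
  proof -
    have "j \<in> (UNIV :: 'n set)" by (rule UNIV_I)
    then show ?thesis unfolding U by (rule singletonD)
  qed
  define c where "c = M $ i $ i"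
  have "M $ j $ k = (c *\<^sub>R mat 1 :: real ^ 'n ^ 'n) $ j $ k" for j k
    unfolding i[of j] i[of k] by (simp add: mat_def c_def)
  then have "M = c *\<^sub>R mat 1" unfolding vec_eq_iff by blast
  then show False using assms by blast
qed

section \<open>Arcs and curves on the unit sphere\<close>

text \<open>A great-circle arc from p to q, run at constant angular speed \<theta> \<le> pi; chords
  are no longer than arcs.\<close>

lemma unit_arc_exists:
  fixes p q :: "'a::euclidean_space"
  assumes D: "2 \<le> DIM('a)" and p: "norm p = 1" and q: "norm q = 1"
  obtains A :: "real \<Rightarrow> 'a" where "A 0 = p" "A 1 = q" "\<And>t. norm (A t) = 1"
    "\<And>s t. dist (A s) (A t) \<le> pi * \<bar>s - t\<bar>"
proof -
  define c where "c = p \<bullet> q"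
  define w where "w = q - c *\<^sub>R p"
  have pp: "p \<bullet> p = 1" "q \<bullet> q = 1" using p q by (simp_all add: dot_square_norm)
  have pw: "p \<bullet> w = 0" by (simp add: w_def c_def inner_diff_right pp)
  have nw: "(norm w)\<^sup>2 = 1 - c\<^sup>2"
    unfolding power2_norm_eq_inner
    by (simp add: w_def inner_diff_left inner_diff_right pp c_def inner_commute power2_eq_square)
  have c: "\<bar>c\<bar> \<le> 1" using Cauchy_Schwarz_ineq2[of p q] p q by (simp add: c_def)
  \<comment> \<open>The vectors p and z span the plane of the arc. If q = p or q = -p then w = 0,
    and any unit vector orthogonal to p serves as z.\<close>
  have "\<exists>z. norm z = 1 \<and> p \<bullet> z = 0 \<and> w = norm w *\<^sub>R z"
  proof (cases "w = 0")
    case True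
    obtain y where "y \<noteq> 0" "orthogonal p y" using orthogonal_to_vector_exists[OF D] by blast
    then show ?thesis using True by (intro exI[of _ "y /\<^sub>R norm y"]) (simp add: orthogonal_def)
  next
    case False
    then show ?thesis using pw by (intro exI[of _ "w /\<^sub>R norm w"]) simp
  qed
  then obtain z where z: "norm z = 1" "p \<bullet> z = 0" "w = norm w *\<^sub>R z" by blast
  have zz: "z \<bullet> z = 1" "z \<bullet> p = 0" using z by (simp_all add: dot_square_norm inner_commute)
  define \<theta> where "\<theta> = arccos c"
  have th: "0 \<le> \<theta>" "\<theta> \<le> pi" using c by (auto simp: \<theta>_def intro: arccos_lbound arccos_ubound)
  define A where "A t = cos (\<theta> * t) *\<^sub>R p + sin (\<theta> * t) *\<^sub>R z" for t
  have ip: "A s \<bullet> A t = cos (\<theta> * (s - t))" for s t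
    by (simp add: A_def inner_add_left inner_add_right pp z zz right_diff_distrib cos_diff)
  have n: "norm (A t) = 1" for t by (simp add: norm_eq_sqrt_inner ip)
  show thesis
  proof (rule that[of A])
    show "A 0 = p" by (simp add: A_def)
    have "norm w = sqrt (1 - c\<^sup>2)" by (rule real_sqrt_unique[symmetric]) (simp_all add: nw)
    then have "sin \<theta> = norm w" using c by (simp add: \<theta>_def sin_arccos_abs)
    moreover have "cos \<theta> = c" using c by (simp add: \<theta>_def cos_arccos_abs)
    ultimately have "A 1 = c *\<^sub>R p + w" using z(3) by (simp add: A_def)
    then show "A 1 = q" by (simp add: w_def)
    fix s t
    define x where "x = \<theta> * (s - t)"
    have "(dist (A s) (A t))\<^sup>2 = (norm (A s))\<^sup>2 + (norm (A t))\<^sup>2 - 2 * (A s \<bullet> A t)"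
      unfolding dist_norm power2_norm_eq_inner
      by (simp add: inner_diff_left inner_diff_right inner_commute)
    also have "\<dots> = 2 - 2 * cos x" by (simp add: n ip x_def)
    also have "\<dots> = (2 * sin (x / 2))\<^sup>2"
      using cos_double_sin[of "x / 2"] by (simp add: power_mult_distrib)
    also have "\<dots> \<le> x\<^sup>2"
    proof -
      have "\<bar>2 * sin (x / 2)\<bar> \<le> \<bar>x\<bar>" using abs_sin_x_le_abs_x[of "x / 2"] by simp
      then show ?thesis by (rule abs_le_square_iff[THEN iffD1])
    qed
    finally have "dist (A s) (A t) \<le> \<bar>x\<bar>"
      using abs_le_square_iff[of "dist (A s) (A t)" x] by simp
    also have "\<bar>x\<bar> \<le> pi * \<bar>s - t\<bar>" using th by (simp add: x_def abs_mult mult_right_mono)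
    finally show "dist (A s) (A t) \<le> pi * \<bar>s - t\<bar>" .
  qed (rule n)
qed

text \<open>Consecutive arcs are glued at the integers. Between times at most 1 apart the arc
  changes at most once, and the triangle inequality passes through that junction.\<close>

lemma unit_curve_through:
  fixes q :: "nat \<Rightarrow> 'a::euclidean_space"
  assumes D: "2 \<le> DIM('a)" and q: "\<And>k. norm (q k) = 1"
  obtains \<gamma> :: "real \<Rightarrow> 'a" where "\<And>k. \<gamma> (real k) = q k" "\<And>t. norm (\<gamma> t) = 1"
    "\<And>s t. 0 \<le> s \<Longrightarrow> s \<le> t \<Longrightarrow> t \<le> s + 1 \<Longrightarrow> dist (\<gamma> s) (\<gamma> t) \<le> pi * (t - s)"
proof -
  have "\<exists>A :: real \<Rightarrow> 'a. A 0 = q k \<and> A 1 = q (Suc k) \<and> (\<forall>t. norm (A t) = 1)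
    \<and> (\<forall>s t. dist (A s) (A t) \<le> pi * \<bar>s - t\<bar>)" for k
    using unit_arc_exists[OF D q[of k] q[of "Suc k"]] by metis
  then obtain A :: "nat \<Rightarrow> real \<Rightarrow> 'a" where A: "\<And>k. A k 0 = q k" "\<And>k. A k 1 = q (Suc k)"
    "\<And>k t. norm (A k t) = 1" "\<And>k s t. dist (A k s) (A k t) \<le> pi * \<bar>s - t\<bar>" by metis
  define \<gamma> where "\<gamma> t = A (nat \<lfloor>t\<rfloor>) (t - real_of_int \<lfloor>t\<rfloor>)" for t :: real
  show thesis
  proof (rule that[of \<gamma>])
    show "\<gamma> (real k) = q k" for k by (simp add: \<gamma>_def A)
    show "norm (\<gamma> t) = 1" for t by (simp add: \<gamma>_def A)
    fix s t :: real assume st: "0 \<le> s" "s \<le> t" "t \<le> s + 1"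
    have "\<lfloor>s\<rfloor> \<le> \<lfloor>t\<rfloor>" "\<lfloor>t\<rfloor> \<le> \<lfloor>s\<rfloor> + 1" using st by linarith+
    then consider "\<lfloor>t\<rfloor> = \<lfloor>s\<rfloor>" | "\<lfloor>t\<rfloor> = \<lfloor>s\<rfloor> + 1" by linarith
    then show "dist (\<gamma> s) (\<gamma> t) \<le> pi * (t - s)"
    proof cases
      case 1
      then show ?thesis using A(4)[of "nat \<lfloor>s\<rfloor>" "s - \<lfloor>s\<rfloor>" "t - \<lfloor>s\<rfloor>"] st by (simp add: \<gamma>_def)
    next
      case 2
      define k where "k = nat \<lfloor>s\<rfloor>"
      have k: "real k = \<lfloor>s\<rfloor>" using st by (simp add: k_def)
      have nk: "nat \<lfloor>t\<rfloor> = Suc k" using st 2 by (simp add: k_def nat_add_distrib)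
      have g: "\<gamma> s = A k (s - k)" "\<gamma> t = A (Suc k) (t - k - 1)"
        using nk 2 by (simp_all add: \<gamma>_def k k_def[symmetric] diff_diff_eq)
      have fl: "k \<le> s" "s \<le> k + 1" "k + 1 \<le> t" using 2 k by linarith+
      have "dist (\<gamma> s) (\<gamma> t) \<le> dist (\<gamma> s) (A k 1) + dist (A (Suc k) 0) (\<gamma> t)"
        using dist_triangle[of "\<gamma> s" "\<gamma> t" "A k 1"] by (simp add: A)
      also have "\<dots> \<le> pi * \<bar>s - k - 1\<bar> + pi * \<bar>0 - (t - k - 1)\<bar>"
        unfolding g by (intro add_mono A(4))
      also have "\<dots> = pi * (t - s)" using fl by (simp add: algebra_simps)
      finally show ?thesis .
    qed
  qed
qed

text \<open>The walk visits the curve at the times \<open>\<delta> * harm n\<close>: these are unbounded, while the squares of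
  their increments have a small sum. Each point of a countable dense set lies on the curve at
  arbitrarily late times.\<close>

lemma dense_slow_walk:
  fixes v :: "'a::euclidean_space"
  assumes D: "2 \<le> DIM('a)" and v: "norm v = 1" and d: "0 < \<delta>" "\<delta> \<le> 1"
  obtains u :: "nat \<Rightarrow> 'a" where "u 1 = v" "\<And>n. norm (u n) = 1"
    "\<And>n. n \<ge> 1 \<Longrightarrow> dist (u n) (u (Suc n)) \<le> pi * \<delta> / n"
    "\<And>x e N. norm x = 1 \<Longrightarrow> 0 < e \<Longrightarrow> \<exists>n\<ge>N. dist (u n) x < e"
proof -
  obtain T where T: "countable T" "T \<subseteq> sphere (0::'a) 1" "sphere 0 1 \<subseteq> closure T"
    using separable[of "sphere (0::'a) 1"] by metis
  have Tne: "T \<noteq> {}" using T v by auto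
  \<comment> \<open>Decoding pairs makes every point of T recur at infinitely many integer times,
    after a start at v.\<close>
  define q where "q k = (case k of 0 \<Rightarrow> v | Suc j \<Rightarrow> from_nat_into T (fst (prod_decode j)))" for k
  have "norm (from_nat_into T j) = 1" for j
    using from_nat_into[OF Tne, of j] T(2) by auto
  then have "norm (q k) = 1" for k using v by (simp add: q_def split: nat.split)
  then obtain \<gamma> where \<gamma>: "\<And>k. \<gamma> (real k) = q k" "\<And>t. norm (\<gamma> t) = 1"
    "\<And>s t. 0 \<le> s \<Longrightarrow> s \<le> t \<Longrightarrow> t \<le> s + 1 \<Longrightarrow> dist (\<gamma> s) (\<gamma> t) \<le> pi * (t - s)"
    using unit_curve_through[OF D] by metis
  define h where "h n = \<delta> * harm n" for n
  have h0: "h 0 = 0" by (simp add: h_def harm_def)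
  have hS: "h (Suc n) = h n + \<delta> / Suc n" for n by (simp add: h_def harm_Suc field_simps)
  have hn: "0 \<le> h n" for n using d by (simp add: h_def harm_nonneg)
  have hm: "h m \<le> h n" if "m \<le> n" for m n
    using lift_Suc_mono_le[of h m n] hS d that by (simp add: field_simps)
  \<comment> \<open>Time increments stay in the range where the speed bound of the curve
    holds.\<close>
  have step: "\<delta> / Suc n \<le> 1" for n using d by (simp add: divide_le_eq)
  have unbounded: "\<exists>n. y < h n" for y
  proof -
    have "filterlim (harm :: nat \<Rightarrow> real) at_top sequentially" by (rule harm_at_top)
    then have "eventually (\<lambda>n. y / \<delta> + 1 \<le> (harm n :: real)) sequentially"
      by (simp add: filterlim_at_top)
    then obtain n where "y / \<delta> + 1 \<le> (harm n :: real)" by (meson eventually_sequentially order_refl)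
    then have "y / \<delta> < harm n" by linarith
    then show ?thesis using d by (auto simp: h_def divide_less_eq mult.commute)
  qed
  show thesis
  \<comment> \<open>The shift by 1 lets the walk begin with \<open>u 1\<close> = v; by truncated
    subtraction \<open>u 0\<close> is v as well.\<close>
  proof (rule that[of "\<lambda>n. \<gamma> (h (n - 1))"])
    show "\<gamma> (h (1 - 1)) = v" using \<gamma>(1)[of 0] by (simp add: h0 q_def)
    show "norm (\<gamma> (h (n - 1))) = 1" for n by (rule \<gamma>)
    show "dist (\<gamma> (h (n - 1))) (\<gamma> (h (Suc n - 1))) \<le> pi * \<delta> / n" if "n \<ge> 1" for n
    proof -
      obtain m where m: "n = Suc m" using \<open>n \<ge> 1\<close> by (cases n) auto
      show ?thesis using \<gamma>(3)[of "h m" "h (Suc m)"] hn[of m] hS[of m] d step[of m] by (simp add: m)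
    qed
    show "\<exists>n\<ge>N. dist (\<gamma> (h (n - 1))) x < e" if x: "norm x = 1" and e: "0 < e" for x e N
    proof -
      have "x \<in> closure T" using T(3) x by auto
      then obtain y where y: "y \<in> T" "dist y x < e / 2"
        using e by (metis closure_approachable half_gt_zero)
      obtain j where j: "from_nat_into T j = y" using from_nat_into_surj[OF T(1) y(1)] by blast
      obtain K where K: "2 * pi / e < real K" using reals_Archimedean2 by blast
      \<comment> \<open>An index beyond N' exceeds N and makes the step bound pi / n smaller than e
        / 2.\<close>
      define N' where "N' = max N K"
      obtain m where m: "h N' < real m" using reals_Archimedean2 by blast
      \<comment> \<open>The code of (j, m) is at least m, so this visit to y happens after the time
        h N'.\<close>
      define k where "k = prod_encode (j, m)"
      have qk: "q (Suc k) = y" by (simp add: q_def k_def j)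
      have km: "m \<le> k" unfolding k_def by (rule le_prod_encode_2)
      \<comment> \<open>The first index whose time exceeds that of the visit; the preceding time h i
        is at most one increment before the visit.\<close>
      define n where "n = (LEAST n. real (Suc k) < h n)"
      have n1: "real (Suc k) < h n" unfolding n_def using unbounded by (rule LeastI_ex)
      have "n \<noteq> 0" using n1 h0 by (metis of_nat_0_le_iff not_less)
      then obtain i where i: "n = Suc i" using not0_implies_Suc by blast
      have n2: "h i \<le> real (Suc k)"
      proof -
        have "i < n" by (simp add: i)
        then show ?thesis unfolding n_def by (rule not_less_Least[THEN linorder_not_less[THEN iffD1]])
      qed
      have "N' < n"
      proof (rule ccontr)
        assume "\<not> N' < n"
        then have "h n \<le> h N'" by (intro hm) simp
        then show False using n1 m km by simp
      qed
      have "dist (\<gamma> (h i)) y \<le> pi * (real (Suc k) - h i)"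
        using \<gamma>(3)[OF hn n2] n1 hS[of i] step[of i] unfolding \<gamma>(1) qk i by simp
      also have "\<dots> \<le> pi * (1 / real n)"
      proof (rule mult_left_mono)
        have "real (Suc k) - h i \<le> \<delta> / Suc i" using n1 hS[of i] by (simp add: i)
        also have "\<dots> \<le> 1 / Suc i" using d by (intro divide_right_mono) auto
        finally show "real (Suc k) - h i \<le> 1 / real n" by (simp add: i)
      qed simp
      also have "\<dots> < e / 2"
      proof -
        have "2 * pi / e < real n" using K \<open>N' < n\<close> by (simp add: N'_def)
        then show ?thesis using e i by (simp add: field_simps)
      qed
      finally have "dist (\<gamma> (h (n - 1))) x < e"
        using y(2) dist_triangle[of "\<gamma> (h i)" x y] by (simp add: i)
      moreover have "N \<le> n" using \<open>N' < n\<close> by (simp add: N'_def)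
      ultimately show ?thesis by blast
    qed
  qed
qed

section \<open>Failure of convergence along the slow walk\<close>

text \<open>Unit vectors at distance d have inner product 1 - d^2 / 2, whose square is at least 1 -
  d^2.\<close>

lemma square_inner_ge:
  fixes x y :: "'a::real_inner"
  assumes "norm x = 1" "norm y = 1"
  shows "1 - (dist x y)\<^sup>2 \<le> (x \<bullet> y)\<^sup>2"
proof -
  have "x \<bullet> x = 1" "y \<bullet> y = 1" using assms by (simp_all add: dot_square_norm)
  then have "(dist x y)\<^sup>2 = 2 - 2 * (x \<bullet> y)"
    unfolding dist_norm power2_norm_eq_inner
    by (simp add: inner_diff_left inner_diff_right inner_commute)
  moreover have "0 \<le> (x \<bullet> y - 1)\<^sup>2" by simp
  ultimately show ?thesis by (simp add: power2_eq_square algebra_simps)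
qed

text \<open>After step n the direction \<open>u n\<close> is an eigenvector with eigenvalue
  \<open>a n\<close>. Turning to the next direction costs at most L \<kappa>^2 / n^2, and these
  losses sum to at most 2 L \<kappa>^2.\<close>

lemma slow_walk_keeps_eigenvalue:
  fixes M :: "real ^ 'n ^ 'n"
  assumes M: "form_between l L M" and l: "0 < l" and u: "\<And>n. norm (u n) = 1"
    and v: "qform M (u 1) = L" and step: "\<And>n. n \<ge> 1 \<Longrightarrow> dist (u n) (u (Suc n)) \<le> \<kappa> / n"
    and n: "n \<ge> 1"
  shows "L - 2 * (L * \<kappa>\<^sup>2) \<le> qform (sstep_seq u n M) (u n)"
proof -
  define a where "a n = qform (sstep_seq u n M) (u n)" for n
  let ?C = "L * \<kappa>\<^sup>2"
  have fb: "form_between l L (sstep_seq u n M)" for n using M l u by (intro form_between_sstep_seq) auto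
  have qa: "qform (sstep_seq u n M) (u (Suc n)) = a (Suc n)" for n
  proof -
    have "0 < qform (sstep_seq u n M) (u (Suc n))"
      using form_between_pos[OF fb l, of "u (Suc n)" n] u[of "Suc n"] by force
    then show ?thesis
      using sstep_direction[OF u[of "Suc n"], of "sstep_seq u n M"] u[of "Suc n"]
      by (simp add: a_def qform_def[of "sstep _ _"] dot_square_norm)
  qed
  have eig: "sstep_seq u (Suc n) M *v u (Suc n) = a (Suc n) *\<^sub>R u (Suc n)" for n
  proof -
    have "0 < qform (sstep_seq u n M) (u (Suc n))"
      using form_between_pos[OF fb l, of "u (Suc n)" n] u[of "Suc n"] by force
    then show ?thesis using sstep_direction[OF u[of "Suc n"], of "sstep_seq u n M"] by (simp add: qa)
  qed
  have up: "0 \<le> a n" "a n \<le> L" for n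
    using form_between_nonneg[OF fb l] fb[of n] u[of n] unfolding a_def form_between_def
    by (auto dest!: spec[of _ "u n"])
  have dec: "a (Suc n) - ?C / (real (Suc n))\<^sup>2 \<le> a (Suc (Suc n))" for n
  proof -
    have sym: "transpose (sstep_seq u (Suc n) M) = sstep_seq u (Suc n) M"
      using fb[of "Suc n"] by (simp add: form_between_def)
    \<comment> \<open>The part of the new direction orthogonal to the old eigenvector contributes a
      nonnegative amount, hence the lower bound 0 in \<open>qform_ge_eigen\<close>.\<close>
    have "a (Suc n) * (u (Suc n) \<bullet> u (Suc (Suc n)))\<^sup>2 \<le> a (Suc (Suc n))"
      using qform_ge_eigen[OF sym u eig u, of 0 "Suc (Suc n)"]
        form_between_nonneg[OF fb l, of "Suc n"] qa[of "Suc n"] by simp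
    moreover have "a (Suc n) * (1 - (dist (u (Suc n)) (u (Suc (Suc n))))\<^sup>2)
        \<le> a (Suc n) * (u (Suc n) \<bullet> u (Suc (Suc n)))\<^sup>2"
      using up by (intro mult_left_mono square_inner_ge u)
    moreover have "a (Suc n) * (dist (u (Suc n)) (u (Suc (Suc n))))\<^sup>2 \<le> L * (\<kappa> / Suc n)\<^sup>2"
      using up[of "Suc n"] step[of "Suc n"] by (intro mult_mono power_mono) auto
    ultimately show ?thesis by (simp add: power_divide algebra_simps)
  qed
  have C: "0 \<le> ?C" using up[of 0] by simp
  \<comment> \<open>The factor 2 - 1/(n+1) dominates the sum of 1/k^2 for k up to n+1, by comparison
    with a telescoping sum.\<close>
  have bound: "L - ?C * (2 - 1 / real (Suc n)) \<le> a (Suc (Suc n))" for n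
  proof (induction n)
    case 0
    have "a 1 = L" using qa[of 0] v by simp
    then show ?case using dec[of 0] by simp
  next
    case (Suc n)
    have "1 / (real (Suc (Suc n)))\<^sup>2 \<le> 1 / real (Suc n) - 1 / real (Suc (Suc n))"
    proof -
      have "1 / real (Suc n) - 1 / real (Suc (Suc n)) = 1 / (real (Suc n) * real (Suc (Suc n)))"
        by (simp add: field_simps)
      moreover have "1 / (real (Suc (Suc n)))\<^sup>2 \<le> 1 / (real (Suc n) * real (Suc (Suc n)))"
        unfolding power2_eq_square by (intro divide_left_mono mult_right_mono) auto
      ultimately show ?thesis by simp
    qed
    then have "?C * (1 / (real (Suc (Suc n)))\<^sup>2) \<le> ?C * (1 / real (Suc n) - 1 / real (Suc (Suc n)))"
      using C by (rule mult_left_mono)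
    then show ?case using Suc dec[of "Suc n"] by (simp add: algebra_simps)
  qed
  show ?thesis
  proof (cases "n = 1")
    case True
    then show ?thesis using qa[of 0] v C by (simp add: a_def)
  next
    case False
    then obtain m where m: "n = Suc (Suc m)" using n by (metis One_nat_def Suc_le_D not0_implies_Suc)
    have "?C * (2 - 1 / real (Suc m)) \<le> ?C * 2" using C by (intro mult_left_mono) auto
    then show ?thesis using bound[of m] unfolding m a_def by linarith
  qed
qed

lemma dense_sequence_without_limit:
  fixes M :: "real ^ 'n ^ 'n"
  assumes M: "symmetric_posdef M" and ns: "\<nexists>c. M = c *\<^sub>R mat 1"
  shows "\<exists>u :: nat \<Rightarrow> real ^ 'n.
    (\<forall>i\<ge>1. u i \<in> sphere 0 1) \<and> sphere 0 1 \<subseteq> closure (u ` {1..}) \<and>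
    (\<nexists>g. g \<in> Cc_plus \<and> uniform_limit UNIV (\<lambda>n. steiner_seq u n (bump M)) g sequentially)"
proof -
  define l L where "l = lambda_min M" and "L = lambda_max M"
  have fb: "form_between l L M" and l: "0 < l"
    using form_between_lambda[OF M] by (auto simp: l_def L_def)
  obtain v where v: "norm v = 1" "qform M v = L"
    using form_between_lambda(3)[OF M] by (auto simp: L_def)
  have "v \<noteq> 0" using v by auto
  then have L: "0 < L" using form_between_pos[OF fb l, of v] v by simp
  have sym: "transpose M = M" and up: "\<And>x. qform M x \<le> L * (norm x)\<^sup>2"
    using fb by (auto simp: form_between_def)
  define d where "d = real CARD('n)"
  have d: "0 < d" by (simp add: d_def)
  have tr: "trace M < d * L" unfolding d_def by (rule trace_less_of_nonscalar[OF sym up ns])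
  \<comment> \<open>The gap between the top eigenvalue and the mean of all eigenvalues. The choice
    of \<delta> keeps the total loss K \<delta>^2 of the walk at most \<eta> / 2.\<close>
  define \<eta> where "\<eta> = L - trace M / d"
  have eta: "0 < \<eta>" using tr d by (simp add: \<eta>_def divide_less_eq mult.commute)
  define K where "K = 2 * (L * pi\<^sup>2)"
  have K: "0 < K" using L by (simp add: K_def)
  define \<delta> where "\<delta> = min 1 (\<eta> / (2 * K))"
  have delta: "0 < \<delta>" "\<delta> \<le> 1" "K * \<delta> \<le> \<eta> / 2"
  proof -
    show "0 < \<delta>" "\<delta> \<le> 1" using eta K by (auto simp: \<delta>_def)
    have "K * \<delta> \<le> K * (\<eta> / (2 * K))" using K by (intro mult_left_mono) (auto simp: \<delta>_def)
    then show "K * \<delta> \<le> \<eta> / 2" using K by simp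
  qed
  have "2 \<le> DIM(real ^ 'n)" using card_ge_2_of_nonscalar[OF ns] by simp
  from dense_slow_walk[OF this v(1) delta(1,2)] obtain u :: "nat \<Rightarrow> real ^ 'n" where
    u1: "u 1 = v" and un: "\<And>n. norm (u n) = 1"
    and step: "\<And>n. n \<ge> 1 \<Longrightarrow> dist (u n) (u (Suc n)) \<le> pi * \<delta> / n"
    and dense: "\<And>x e N. norm x = 1 \<Longrightarrow> 0 < e \<Longrightarrow> \<exists>n\<ge>N. dist (u n) x < e"
    by metis
  define X where "X n = sstep_seq u n M" for n
  have fX: "form_between l L (X n)" for n
    unfolding X_def using fb l un by (intro form_between_sstep_seq) auto
  define a where "a = L - 2 * (L * (pi * \<delta>)\<^sup>2)"
  have keep: "a \<le> qform (X n) (u n)" if "n \<ge> 1" for n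
    unfolding a_def X_def
    by (rule slow_walk_keeps_eigenvalue[OF fb l un _ step that]) (simp_all add: u1[simplified] v)
  have a: "trace M < d * a"
  proof -
    have "K * \<delta>\<^sup>2 \<le> K * \<delta>" using delta K by (simp add: power2_eq_square mult_left_le)
    then have "\<eta> / 2 \<le> \<eta> - K * \<delta>\<^sup>2" using delta(3) by simp
    then have "0 < \<eta> - K * \<delta>\<^sup>2" using eta by simp
    also have "\<dots> = a - trace M / d" by (simp add: \<eta>_def a_def K_def power_mult_distrib)
    finally show ?thesis using d by (simp add: divide_less_eq mult.commute)
  qed
  have trX: "trace (X n) \<le> trace M" for n
  proof (induction n)
    case (Suc n)
    have "trace (X (Suc n)) \<le> trace (X n)"
      unfolding X_def sstep_seq.simps by (rule trace_sstep_le[OF fX[unfolded X_def] l un])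
    then show ?case using Suc by simp
  qed (simp add: X_def)
  \<comment> \<open>On the sphere of radius 1 / sqrt L the truncation is inactive for all n, so a
    limit there still sees the quadratic forms.\<close>
  define r where "r = 1 / sqrt L"
  have r: "r\<^sup>2 = 1 / L" using L by (simp add: r_def power_divide)
  have S: "steiner_seq u n (bump M) = bump (X n)" for n
    unfolding X_def using fb l un by (intro steiner_seq_bump) auto
  have b: "bump (X n) (r *\<^sub>R x) = 1 - qform (X n) x / L" if "norm x = 1" for n x
  proof -
    have "qform (X n) x \<le> L" using fX[of n] that unfolding form_between_def by (metis mult.right_neutral one_power2)
    then show ?thesis using L by (simp add: bump_def qform_scale r)
  qed
  have "\<not> uniform_limit UNIV (\<lambda>n. steiner_seq u n (bump M)) g sequentially" if g: "g \<in> Cc_plus" for g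
  proof
    assume "uniform_limit UNIV (\<lambda>n. steiner_seq u n (bump M)) g sequentially"
    then have ul: "uniform_limit UNIV (\<lambda>n. bump (X n)) g sequentially" by (simp add: S)
    \<comment> \<open>The walk comes close to x at arbitrarily late n, where the form at
      \<open>u n\<close> is at least a. Uniform convergence and continuity of g carry this bound
      over to x.\<close>
    have g_le: "g (r *\<^sub>R x) \<le> 1 - a / L" if x: "norm x = 1" for x
    proof (rule field_le_epsilon)
      fix e :: real assume e: "0 < e"
      have "eventually (\<lambda>n. \<forall>y\<in>UNIV. dist (bump (X n) y) (g y) < e / 2) sequentially"
        using ul half_gt_zero[OF e] unfolding uniform_limit_iff by blast
      then obtain N where N: "\<And>n y. n \<ge> N \<Longrightarrow> dist (bump (X n) y) (g y) < e / 2"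
        by (auto simp: eventually_sequentially)
      have "continuous_on UNIV g" using g by (simp add: Cc_plus_def)
      then have "continuous_on UNIV (\<lambda>y. g (r *\<^sub>R y))"
        by (rule continuous_on_compose2) (auto intro!: continuous_intros)
      then obtain h where h: "0 < h" "\<And>y. dist y x < h \<Longrightarrow> dist (g (r *\<^sub>R y)) (g (r *\<^sub>R x)) < e / 2"
        using e unfolding continuous_on_iff by (metis UNIV_I half_gt_zero)
      obtain n where n: "n \<ge> max N 1" "dist (u n) x < h" using dense[OF x h(1)] by blast
      have "g (r *\<^sub>R x) < bump (X n) (r *\<^sub>R u n) + e"
      proof -
        have "n \<ge> N" using n(1) by simp
        from N[OF this, of "r *\<^sub>R u n"] h(2)[OF n(2)] show ?thesis
          unfolding dist_real_def by linarith
      qed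
      also have "bump (X n) (r *\<^sub>R u n) \<le> 1 - a / L"
        using keep[of n] n(1) L by (simp add: b un divide_right_mono)
      finally show "g (r *\<^sub>R x) \<le> 1 - a / L + e" by simp
    qed
    \<comment> \<open>Summing over the axes produces traces: the limit is at least d - tr M / L, yet
      by the bound at each axis at most d - d a / L.\<close>
    have "(\<lambda>n. \<Sum>i\<in>UNIV. bump (X n) (r *\<^sub>R axis i 1)) \<longlonglongrightarrow> (\<Sum>i\<in>UNIV. g (r *\<^sub>R axis i 1))"
      by (intro tendsto_sum tendsto_uniform_limitI[OF ul]) simp
    moreover have "d - trace M / L \<le> (\<Sum>i\<in>UNIV. bump (X n) (r *\<^sub>R axis i 1))" for n
    proof -
      have "(\<Sum>i\<in>UNIV. bump (X n) (r *\<^sub>R axis i 1)) = d - trace (X n) / L"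
        by (simp add: b trace_eq_qform sum_subtractf sum_divide_distrib d_def)
      then show ?thesis using trX[of n] L by (simp add: divide_right_mono)
    qed
    ultimately have "d - trace M / L \<le> (\<Sum>i\<in>UNIV. g (r *\<^sub>R axis i 1))"
      by (intro LIMSEQ_le_const) auto
    also have "\<dots> \<le> (\<Sum>i\<in>(UNIV::'n set). 1 - a / L)" by (intro sum_mono g_le) simp
    also have "\<dots> = d - d * a / L" by (simp add: d_def right_diff_distrib)
    finally have "d * a / L \<le> trace M / L" by simp
    then show False using a L by (simp add: divide_le_cancel)
  qed
  moreover have "sphere 0 1 \<subseteq> closure (u ` {1..})"
  proof
    fix x :: "real ^ 'n" assume "x \<in> sphere 0 1"
    then have "\<exists>n\<ge>1. dist (u n) x < e" if "0 < e" for e using dense[of x e 1] that by simp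
    then show "x \<in> closure (u ` {1..})" unfolding closure_approachable by blast
  qed
  ultimately show ?thesis using un by (intro exI[of _ u]) auto
qed

theorem proposition6p2:
  fixes M :: "real ^ 'n ^ 'n" and f :: "real ^ 'n \<Rightarrow> real"
  assumes "symmetric_posdef M"
    and "f = (\<lambda>x. max (1 - x \<bullet> (M *v x)) 0)"
  shows
    "(\<forall>(P :: 'w measure) (U :: nat \<Rightarrow> 'w \<Rightarrow> real ^ 'n).
        prob_space P \<longrightarrow> iid_uniform_sphere P U \<longrightarrow> lambda_max M \<le> 2 * lambda_min M \<longrightarrow>
        (\<forall>n\<ge>1.
          prob_space.expectation P
            (\<lambda>\<omega>. sup_norm (\<lambda>x. steiner_seq (\<lambda>i. U i \<omega>) n f x - rearrangement f x))
          \<ge> 1 / 4 * sup_norm (\<lambda>x. f x - rearrangement f x) * (1 / 3) ^ n))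
     \<and>
     ((\<nexists>c. M = c *\<^sub>R mat 1) \<longrightarrow>
        (\<exists>u :: nat \<Rightarrow> real ^ 'n.
          (\<forall>i\<ge>1. u i \<in> sphere 0 1) \<and> sphere 0 1 \<subseteq> closure (u ` {1..}) \<and>
          (\<nexists>g. g \<in> Cc_plus \<and> uniform_limit UNIV (\<lambda>n. steiner_seq u n f) g sequentially)))"
proof -
  have f: "f = bump M" unfolding assms(2) bump_def[abs_def] qform_def by simp
  show ?thesis unfolding f
    using expected_distance_lower_bound[OF assms(1)] dense_sequence_without_limit[OF assms(1)] by blast
qed

end
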